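(* Let $\mathbb{K}$ be a field of characteristic $0$, let $a\in\mathbb{Q}$, and let $n,k\geq 1$ be integers. Let $f_1,\ldots,f_n\in\mathbb{K}[u]$ and $Q_1,\ldots,Q_n\in\mathbb{K}[y_1,\ldots,y_{n(k+1)},t,u]$ be polynomials. For $F\in\mathbb{K}[u][[t]]$ set $\nabla^k F:=(F,\Delta_aF,\ldots,\Delta_a^kF)$. Then the system of equations $$F_i=f_i(u)+t\cdot Q_i(\nabla^kF_1,\ldots,\nabla^kF_n,t,u),\qquad i=1,\ldots,n,$$ admits a unique vector of solutions $(F_1,\ldots,F_n)\in\mathbb{K}[u][[t]]^n$, and every component $F_i$ is algebraic over $\mathbb{K}(t,u)$.
   Context: The operator $\Delta_a:\mathbb{K}[u][[t]]\to\mathbb{K}[u][[t]]$ is defined by $\Delta_aF(t,u):=\frac{F(t,u)-F(t,a)}{u-a}$, and $\Delta_a^\ell$ denotes its $\ell$-th iterate. In the system, the $n(k+1)$ variables $y_1,\ldots,y_{n(k+1)}$ of $Q_i$ are substituted by the $n(k+1)$ entries of $\nabla^kF_1,\ldots,\nabla^kF_n$ in this order. *)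

theory Defs
  imports
    "HOL-Computational_Algebra.Computational_Algebra"
    "HOL-Library.Poly_Mapping"
begin

text \<open>The ring \<open>\<bbbK>[u][[t]]\<close> is the type \<open>'a poly fps\<close>: \<open>t\<close> is \<^term>\<open>fps_X\<close>, and \<open>u\<close> is
  the variable of the coefficient polynomials.\<close>

definition fps_u :: "'a::comm_ring_1 poly fps" where
  "fps_u = fps_const [:0, 1:]"

definition fps_scalar :: "'a::comm_ring_1 \<Rightarrow> 'a poly fps" where
  "fps_scalar c = fps_const [:c:]"

definition eval_u :: "'a::comm_ring_1 \<Rightarrow> 'a poly fps \<Rightarrow> 'a poly fps" where
  "eval_u c F = Abs_fps (\<lambda>m. [:poly (fps_nth F m) c:])"

text \<open>Division by \<open>u - c\<close> is carried out on each coefficient of \<open>F(t,u) - F(t,c)\<close>; it is exact by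
  the lemma that follows.\<close>

definition Delta :: "'a::field \<Rightarrow> 'a poly fps \<Rightarrow> 'a poly fps" where
  "Delta c F = Abs_fps (\<lambda>m. fps_nth (F - eval_u c F) m div [:-c, 1:])"

lemma Delta_mult: "(fps_u - fps_scalar c) * Delta c F = F - eval_u c F"
proof (rule fps_ext)
  fix m
  have "[:-c, 1:] dvd fps_nth F m - [:poly (fps_nth F m) c:]"
    by (simp flip: poly_eq_0_iff_dvd)
  then have "[:-c, 1:] * ((fps_nth F m - [:poly (fps_nth F m) c:]) div [:-c, 1:])
      = fps_nth F m - [:poly (fps_nth F m) c:]"
    by (rule dvd_mult_div_cancel)
  moreover have "fps_u - fps_scalar c = fps_const [:-c, 1:]"
    by (simp add: fps_u_def fps_scalar_def)
  ultimately show "fps_nth ((fps_u - fps_scalar c) * Delta c F) m = fps_nth (F - eval_u c F) m"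
    by (simp add: Delta_def eval_u_def)
qed

definition nabla :: "'a::field \<Rightarrow> nat \<Rightarrow> 'a poly fps \<Rightarrow> 'a poly fps list" where
  "nabla c k F = map (\<lambda>l. (Delta c ^^ l) F) [0..<Suc k]"

text \<open>Multivariate polynomials are finitely supported maps from monomials (finitely supported
  exponent maps) to coefficients. The variable \<open>y\<^sub>j\<close> is \<open>VarY (j - 1)\<close>.\<close>

datatype var = VarY nat | VarT | VarU

type_synonym 'a mpoly = "(var \<Rightarrow>\<^sub>0 nat) \<Rightarrow>\<^sub>0 'a"

definition indets :: "'a::zero mpoly \<Rightarrow> var set" where
  "indets Q = (\<Union>m\<in>Poly_Mapping.keys Q. Poly_Mapping.keys m)"

definition mpolys_in :: "nat \<Rightarrow> 'a::zero mpoly set" where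
  "mpolys_in N = {Q. indets Q \<subseteq> VarY ` {..<N} \<union> {VarT, VarU}}"

definition subst_mpoly :: "(var \<Rightarrow> 'a::comm_ring_1 poly fps) \<Rightarrow> 'a mpoly \<Rightarrow> 'a poly fps" where
  "subst_mpoly x Q =
    (\<Sum>m\<in>Poly_Mapping.keys Q. fps_scalar (Poly_Mapping.lookup Q m) *
      (\<Prod>v\<in>Poly_Mapping.keys m. x v ^ Poly_Mapping.lookup m v))"

primrec assign :: "'a::comm_ring_1 poly fps list \<Rightarrow> var \<Rightarrow> 'a poly fps" where
  "assign ys (VarY j) = ys ! j"
| "assign ys VarT = fps_X"
| "assign ys VarU = fps_u"

definition is_solution ::
  "'a::field \<Rightarrow> nat \<Rightarrow> 'a poly list \<Rightarrow> 'a mpoly list \<Rightarrow> 'a poly fps list \<Rightarrow> bool" where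
  "is_solution c k fs Qs Fs \<longleftrightarrow>
    (\<forall>i<length Fs. Fs ! i = fps_const (fs ! i) +
      fps_X * subst_mpoly (assign (concat (map (nabla c k) Fs))) (Qs ! i))"

text \<open>The field \<open>\<bbbK>(t,u)\<close>, as a subfield of the fraction field of \<open>\<bbbK>[u][[t]]\<close>; an element of
  \<open>'a poly poly\<close> is a polynomial in \<open>t\<close> over \<open>\<bbbK>[u]\<close>.\<close>

definition rat_funs :: "'a::field poly fps fract set" where
  "rat_funs = {to_fract (fps_of_poly p) / to_fract (fps_of_poly q) | p q. q \<noteq> 0}"

definition algebraic_over :: "'b::field set \<Rightarrow> 'b \<Rightarrow> bool" where
  "algebraic_over K x \<longleftrightarrow> (\<exists>P. P \<noteq> 0 \<and> (\<forall>j. coeff P j \<in> K) \<and> poly P x = 0)"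

end

theory Submission
  imports Defs "Jordan_Normal_Form.Determinant"
begin

text \<open>Write \<open>v = u - a\<close>. Existence and uniqueness follow since the right-hand side is a \<open>t\<close>-adic
  contraction. For algebraicity, let \<open>y\<^sub>j\<^sub>m\<close> be the value of \<open>\<Delta>\<^sup>m F\<^sub>j\<close> at \<open>u = a\<close> for \<open>m < k\<close>. Multiplying the
  system by \<open>v^k\<close> turns it into polynomial equations over \<open>\<bbbK>(t, u, y)\<close> whose Jacobian determinant \<open>d\<close>
  is \<open>v^(k n)\<close> modulo \<open>t\<close>, hence nonzero, so it suffices that the \<open>y\<^sub>j\<^sub>m\<close> are algebraic, that is, that
  every derivation \<open>D\<close> from \<open>\<bbbK>[[t]]\<close> to \<open>\<bbbK>((t))\<close> that vanishes on \<open>\<bbbK>[t]\<close> vanishes on them.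

  Extend \<open>D\<close> by \<open>D u = 0\<close> to \<open>\<bbbK>[[t]][u]\<close>. If \<open>D F\<close> made sense in \<open>\<bbbK>[u][[t]]\<close> up to a common denominator,
  it would solve a homogeneous linear catalytic system and vanish by uniqueness. To replace it, take by
  Weierstrass division a multiple \<open>W\<close> of \<open>d\<close> that is monic in \<open>u\<close>, and \<open>r \<equiv> F\<close> modulo \<open>v^k W\<^sup>2\<close> with \<open>r\<close>
  in \<open>\<bbbK>[[t]][u]\<close>. Then \<open>D r\<close> satisfies the linear system up to multiples of \<open>W\<close>, and these are
  the contributions of multiples of \<open>v^k\<close>, because \<open>W\<close> kills the cokernel of the Jacobian matrix. So \<open>D r\<close> is
  divisible by \<open>v^k\<close>, and its first \<open>k\<close> Taylor coefficients at \<open>u = a\<close> are the \<open>D y\<^sub>j\<^sub>m\<close>.\<close>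

no_notation vec_index (infixl "$" 100)

section \<open>Extension of derivations in characteristic zero\<close>

definition is_subfield :: "'b::field set \<Rightarrow> bool" where
  "is_subfield E \<longleftrightarrow> 0 \<in> E \<and> 1 \<in> E \<and>
    (\<forall>x\<in>E. \<forall>y\<in>E. x + y \<in> E \<and> x - y \<in> E \<and> x * y \<in> E \<and> x / y \<in> E)"

text \<open>Only the arguments are confined to \<open>E\<close>; the values may lie anywhere in the
  ambient field. This covers derivations from a field into a larger one.\<close>

definition derivation_on :: "'b::field set \<Rightarrow> ('b \<Rightarrow> 'b) \<Rightarrow> bool" where
  "derivation_on E D \<longleftrightarrow>
    (\<forall>x\<in>E. \<forall>y\<in>E. D (x + y) = D x + D y \<and> D (x * y) = x * D y + y * D x)"

lemma subfield_sum: "is_subfield E \<Longrightarrow> (\<And>i. i \<in> I \<Longrightarrow> f i \<in> E) \<Longrightarrow> sum f I \<in> E"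
  by (induction I rule: infinite_finite_induct) (auto simp: is_subfield_def)

lemma subfield_power: "is_subfield E \<Longrightarrow> x \<in> E \<Longrightarrow> x ^ m \<in> E"
  by (induction m) (auto simp: is_subfield_def)

lemma subfield_poly:
  assumes "is_subfield E" "\<And>i. coeff p i \<in> E" "x \<in> E"
  shows "poly p x \<in> E"
  unfolding poly_altdef
  by (rule subfield_sum[OF assms(1)])
    (use assms subfield_power[OF assms(1,3)] in \<open>auto simp: is_subfield_def\<close>)

lemma subfield_coeff_pderiv:
  assumes "is_subfield E" "\<And>i. coeff p i \<in> E"
  shows "coeff (pderiv p) i \<in> E"
proof -
  have "of_nat m \<in> E" for m
    using assms(1) by (induction m) (auto simp: is_subfield_def)
  then show ?thesis
    using assms unfolding coeff_pderiv is_subfield_def by blast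
qed

text \<open>A pair \<open>(x, a)\<close> stands for the dual number \<open>x + a \<epsilon>\<close>; the graph of a derivation is a subring
  of the dual numbers that contains no nonzero multiple of \<open>\<epsilon>\<close>.\<close>

definition dual_ring :: "'b::field set \<Rightarrow> ('b \<times> 'b) set \<Rightarrow> bool" where
  "dual_ring M V \<longleftrightarrow> V \<subseteq> M \<times> M \<and> (0, 0) \<in> V \<and> (1, 0) \<in> V \<and> (\<forall>a. (0, a) \<in> V \<longrightarrow> a = 0) \<and>
    (\<forall>x a y b. (x, a) \<in> V \<longrightarrow> (y, b) \<in> V \<longrightarrow>
      (x + y, a + b) \<in> V \<and> (x - y, a - b) \<in> V \<and> (x * y, x * b + y * a) \<in> V)"

text \<open>The second clause is the quotient rule. For \<open>y = 0\<close> it only asks for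
  \<open>(0, 0)\<close>, by the convention \<open>x / 0 = 0\<close>.\<close>

definition derivation_graph :: "'b::field set \<Rightarrow> ('b \<times> 'b) set \<Rightarrow> bool" where
  "derivation_graph M R \<longleftrightarrow> dual_ring M R \<and>
    (\<forall>x a y b. (x, a) \<in> R \<longrightarrow> (y, b) \<in> R \<longrightarrow> (x / y, (a * y - x * b) / y\<^sup>2) \<in> R)"

definition dual_frac :: "('b::field \<times> 'b) set \<Rightarrow> ('b \<times> 'b) set" where
  "dual_frac V = {(x / y, (a * y - x * b) / y\<^sup>2) | x a y b. (x, a) \<in> V \<and> (y, b) \<in> V \<and> y \<noteq> 0}"

lemma dual_fracI:
  "(x, a) \<in> V \<Longrightarrow> (y, b) \<in> V \<Longrightarrow> y \<noteq> 0 \<Longrightarrow> z = x / y \<Longrightarrow> c = (a * y - x * b) / y\<^sup>2 \<Longrightarrow>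
    (z, c) \<in> dual_frac V"
  unfolding dual_frac_def by blast

lemma dual_ring_unique:
  assumes "dual_ring M V" "(x, a) \<in> V" "(x, b) \<in> V"
  shows "a = b"
proof -
  have "(x - x, a - b) \<in> V" using assms unfolding dual_ring_def by blast
  then show ?thesis using assms(1) unfolding dual_ring_def by auto
qed

lemma derivation_graphD:
  assumes "derivation_graph M R" "(x, a) \<in> R" "(y, b) \<in> R"
  shows "(x + y, a + b) \<in> R" "(x - y, a - b) \<in> R" "(x * y, x * b + y * a) \<in> R"
    "(x / y, (a * y - x * b) / y\<^sup>2) \<in> R"
  using assms by (simp_all add: derivation_graph_def dual_ring_def)

text \<open>A dual number with nonzero first component is invertible, so \<open>dual_frac V\<close>
  is a ring of fractions. A fraction with first component 0 has a numerator \<open>(0, p')\<close>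
  in \<open>V\<close>, which forces \<open>p' = 0\<close>.\<close>

lemma derivation_graph_dual_frac:
  assumes M: "is_subfield M" and V: "dual_ring M V"
  shows "derivation_graph M (dual_frac V)"
proof -
  have plus: "(x + y, a + b) \<in> V" and minus: "(x - y, a - b) \<in> V"
    and mult: "(x * y, x * b + y * a) \<in> V" if "(x, a) \<in> V" "(y, b) \<in> V" for x a y b
    using V that unfolding dual_ring_def by blast+
  have V0: "a = 0" if "(0, a) \<in> V" for a
    using V that unfolding dual_ring_def by blast
  have cl: "(x + y, a + b) \<in> dual_frac V \<and> (x - y, a - b) \<in> dual_frac V \<and>
     (x * y, x * b + y * a) \<in> dual_frac V \<and> (x / y, (a * y - x * b) / y\<^sup>2) \<in> dual_frac V"
    if "(x, a) \<in> dual_frac V" "(y, b) \<in> dual_frac V" for x a y b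
  proof -
    obtain p p' q q' where p: "(p, p') \<in> V" "(q, q') \<in> V" "q \<noteq> 0" "x = p / q"
        "a = (p' * q - p * q') / q\<^sup>2"
      using \<open>(x, a) \<in> dual_frac V\<close> unfolding dual_frac_def by blast
    obtain r r' s s' where r: "(r, r') \<in> V" "(s, s') \<in> V" "s \<noteq> 0" "y = r / s"
        "b = (r' * s - r * s') / s\<^sup>2"
      using \<open>(y, b) \<in> dual_frac V\<close> unfolding dual_frac_def by blast
    note m = mult[OF p(1) r(1)] mult[OF p(1) r(2)] mult[OF p(2) r(1)] mult[OF p(2) r(2)]
    have "(x + y, a + b) \<in> dual_frac V"
      by (rule dual_fracI[OF plus[OF m(2,3)] m(4)])
        (use p(3) r(3) in \<open>auto simp: p(4,5) r(4,5) field_simps power2_eq_square\<close>)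
    moreover have "(x - y, a - b) \<in> dual_frac V"
      by (rule dual_fracI[OF minus[OF m(2,3)] m(4)])
        (use p(3) r(3) in \<open>auto simp: p(4,5) r(4,5) field_simps power2_eq_square\<close>)
    moreover have "(x * y, x * b + y * a) \<in> dual_frac V"
      by (rule dual_fracI[OF m(1) m(4)])
        (use p(3) r(3) in \<open>auto simp: p(4,5) r(4,5) field_simps power2_eq_square\<close>)
    moreover have "(x / y, (a * y - x * b) / y\<^sup>2) \<in> dual_frac V"
    proof (cases "r = 0")
      case True
      have "(0, 0) \<in> V" "(1, 0) \<in> V" using V unfolding dual_ring_def by blast+
      from dual_fracI[OF this] have "(0, 0) \<in> dual_frac V" by simp
      then show ?thesis using True r by simp
    next
      case False
      show ?thesis
        by (rule dual_fracI[OF m(2) m(3)])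
          (use p(3) r(3) False in \<open>auto simp: p(4,5) r(4,5) field_simps power2_eq_square\<close>)
    qed
    ultimately show ?thesis by blast
  qed
  have V01: "(0, 0) \<in> V" "(1, 0) \<in> V" using V unfolding dual_ring_def by blast+
  have "(0, 0) \<in> dual_frac V" "(1, 0) \<in> dual_frac V"
    using dual_fracI[OF V01(1,2)] dual_fracI[OF V01(2,2)] by simp_all
  moreover have "dual_frac V \<subseteq> M \<times> M"
  proof
    fix z assume "z \<in> dual_frac V"
    then obtain x a y b where *: "z = (x / y, (a * y - x * b) / y\<^sup>2)" "(x, a) \<in> V" "(y, b) \<in> V"
      unfolding dual_frac_def by blast
    then have "x \<in> M" "y \<in> M" "a \<in> M" "b \<in> M" using V unfolding dual_ring_def by auto
    then show "z \<in> M \<times> M" using M *(1) unfolding is_subfield_def power2_eq_square by blast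
  qed
  moreover have "a = 0" if za: "(0, a) \<in> dual_frac V" for a
  proof -
    obtain p p' q q' where p: "(p, p') \<in> V" "(q, q') \<in> V" "q \<noteq> 0" "0 = p / q"
        "a = (p' * q - p * q') / q\<^sup>2"
      using za unfolding dual_frac_def by blast
    then have "p = 0" by simp
    with p V0 show ?thesis by auto
  qed
  ultimately show ?thesis
    unfolding derivation_graph_def dual_ring_def using cl by blast
qed

section \<open>Adjoining one element to the domain of a derivation\<close>

definition poly_pair :: "('b::field \<times> 'b) set \<Rightarrow> 'b poly \<Rightarrow> 'b poly \<Rightarrow> bool" where
  "poly_pair R p p' \<longleftrightarrow> (\<forall>i. (coeff p i, coeff p' i) \<in> R)"

lemma poly_pair_arith:
  assumes R: "dual_ring M R" and p: "poly_pair R p p'" and q: "poly_pair R q q'"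
  shows "poly_pair R (p + q) (p' + q')" "poly_pair R (p - q) (p' - q')"
    "poly_pair R (p * q) (p * q' + q * p')"
proof -
  have plus: "(x + y, a + b) \<in> R" and minus: "(x - y, a - b) \<in> R"
    and mult: "(x * y, x * b + y * a) \<in> R" if "(x, a) \<in> R" "(y, b) \<in> R" for x a y b
    using R that unfolding dual_ring_def by blast+
  have R0: "(0, 0) \<in> R" using R unfolding dual_ring_def by blast
  show "poly_pair R (p + q) (p' + q')" "poly_pair R (p - q) (p' - q')"
    using p q plus minus by (auto simp: poly_pair_def)
  have sum: "(sum f I, sum g I) \<in> R" if "\<And>i. i \<in> I \<Longrightarrow> (f i, g i) \<in> R" for f g :: "nat \<Rightarrow> 'a" and I
    using that by (induction I rule: infinite_finite_induct) (auto simp: R0 plus)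
  show "poly_pair R (p * q) (p * q' + q * p')"
    unfolding poly_pair_def
  proof
    fix m
    have "coeff (p * q' + q * p') m =
        (\<Sum>i\<le>m. coeff p i * coeff q' (m - i) + coeff q (m - i) * coeff p' i)"
      by (simp add: mult.commute[of q p'] coeff_mult sum.distrib mult.commute)
    moreover have "(\<Sum>i\<le>m. coeff p i * coeff q (m - i),
        \<Sum>i\<le>m. coeff p i * coeff q' (m - i) + coeff q (m - i) * coeff p' i) \<in> R"
      by (rule sum) (use p q mult in \<open>auto simp: poly_pair_def\<close>)
    ultimately show "(coeff (p * q) m, coeff (p * q' + q * p') m) \<in> R"
      by (simp add: coeff_mult)
  qed
qed

lemma poly_pair_monom:
  "dual_ring M R \<Longrightarrow> (y, b) \<in> R \<Longrightarrow> poly_pair R (monom y m) (monom b m)"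
  by (auto simp: poly_pair_def dual_ring_def)

text \<open>Once \<open>x\<close> is sent to \<open>d\<close>, the value at \<open>poly p x\<close>
  is forced; \<open>p'\<close> is \<open>p\<close> with the derivation applied to its coefficients.
  By \<open>compat\<close>, relations satisfied by \<open>x\<close> yield no nonzero multiple of
  epsilon, so the forced pairs form a dual ring \<open>V\<close>, and its fractions give the
  extension.\<close>

lemma derivation_graph_adjoin:
  assumes M: "is_subfield M" and R: "derivation_graph M R" and x: "x \<in> M" and d: "d \<in> M"
    and compat: "\<And>p p'. poly_pair R p p' \<Longrightarrow> poly p x = 0 \<Longrightarrow>
      poly p' x + poly (pderiv p) x * d = 0"
  shows "\<exists>R'. derivation_graph M R' \<and> R \<subseteq> R' \<and> (x, d) \<in> R'"
proof -
  have dr: "dual_ring M R" using R unfolding derivation_graph_def by blast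
  define V where "V = {(poly p x, poly p' x + poly (pderiv p) x * d) | p p'. poly_pair R p p'}"
  have RV: "(y, b) \<in> V" if "(y, b) \<in> R" for y b
  proof -
    have "poly_pair R [:y:] [:b:]" using poly_pair_monom[OF dr that, of 0] by (simp add: monom_0)
    then show ?thesis unfolding V_def by force
  qed
  have R01: "(0, 0) \<in> R" "(1, 0) \<in> R" using dr unfolding dual_ring_def by blast+
  have xV: "(x, d) \<in> V"
  proof -
    have "poly_pair R (monom 1 1) 0" using poly_pair_monom[OF dr R01(2), of 1] by simp
    then have "(poly (monom 1 1) x, poly 0 x + poly (pderiv (monom 1 1)) x * d) \<in> V"
      unfolding V_def by blast
    then show ?thesis by (simp add: poly_monom pderiv_monom)
  qed
  have "dual_ring M V"
    unfolding dual_ring_def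
  proof (intro conjI allI impI)
    show "V \<subseteq> M \<times> M"
    proof
      fix z assume "z \<in> V"
      then obtain p p' where z: "z = (poly p x, poly p' x + poly (pderiv p) x * d)"
        and p: "poly_pair R p p'" unfolding V_def by blast
      have c: "coeff p i \<in> M" "coeff p' i \<in> M" for i
        using p dr unfolding poly_pair_def dual_ring_def by blast+
      have "poly p x \<in> M" "poly p' x \<in> M" "poly (pderiv p) x \<in> M"
        by (intro subfield_poly M c x subfield_coeff_pderiv)+
      then show "z \<in> M \<times> M" using z M d unfolding is_subfield_def by auto
    qed
    show "(0, 0) \<in> V" "(1, 0) \<in> V" using RV R01 by blast+
    show "a = 0" if "(0, a) \<in> V" for a
      using that compat unfolding V_def by force
    fix y a z b assume "(y, a) \<in> V" "(z, b) \<in> V"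
    then obtain p p' q q' where p: "poly_pair R p p'" "y = poly p x"
        "a = poly p' x + poly (pderiv p) x * d"
      and q: "poly_pair R q q'" "z = poly q x" "b = poly q' x + poly (pderiv q) x * d"
      unfolding V_def by blast
    note ar = poly_pair_arith[OF dr p(1) q(1)]
    show "(y + z, a + b) \<in> V"
      using ar(1) unfolding V_def mem_Collect_eq
      by (intro exI[of _ "p + q"] exI[of _ "p' + q'"]) (auto simp: p q pderiv_add algebra_simps)
    show "(y - z, a - b) \<in> V"
      using ar(2) unfolding V_def mem_Collect_eq
      by (intro exI[of _ "p - q"] exI[of _ "p' - q'"]) (auto simp: p q pderiv_diff algebra_simps)
    show "(y * z, y * b + z * a) \<in> V"
      using ar(3) unfolding V_def mem_Collect_eq
      by (intro exI[of _ "p * q"] exI[of _ "p * q' + q * p'"])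
        (auto simp: p q pderiv_mult algebra_simps)
  qed
  from derivation_graph_dual_frac[OF M this] have "derivation_graph M (dual_frac V)" .
  moreover have "z \<in> dual_frac V" if "z \<in> V" for z
    using dual_fracI[of "fst z" "snd z" V 1 0] that RV[OF R01(2)] by (cases z) auto
  ultimately show ?thesis using RV xV by (intro exI[of _ "dual_frac V"]) auto
qed

lemma poly_pair_lift:
  assumes "dual_ring M R" "\<And>i. coeff p i \<in> Domain R"
  obtains p' where "poly_pair R p p'"
proof -
  have "\<forall>i. \<exists>a. (coeff p i, a) \<in> R" using assms(2) by (auto simp: Domain_iff)
  then obtain f where f: "\<And>i. (coeff p i, f i) \<in> R" by metis
  have "f i = 0" if "i > degree p" for i
    using f[of i] that assms(1) by (auto simp: coeff_eq_0 dual_ring_def)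
  then have "coeff (Abs_poly f) = f"
    by (intro coeff_Abs_poly[of "degree p"])
  then show ?thesis using that[of "Abs_poly f"] f by (simp add: poly_pair_def)
qed

text \<open>Differentiating \<open>poly mu x = 0\<close>, for \<open>mu\<close> of least degree,
  gives a linear equation for \<open>d\<close>. It is solvable: in characteristic zero
  \<open>pderiv mu\<close> is nonzero of smaller degree, hence does not vanish at
  \<open>x\<close>.\<close>

lemma derivation_graph_adjoin_algebraic:
  fixes M :: "'b::field_char_0 set"
  assumes M: "is_subfield M" and R: "derivation_graph M R" and x: "x \<in> M"
    and alg: "algebraic_over (Domain R) x"
  shows "\<exists>R' d. derivation_graph M R' \<and> R \<subseteq> R' \<and> (x, d) \<in> R'"
proof -
  have dr: "dual_ring M R" using R unfolding derivation_graph_def by blast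
  define P where "P m \<longleftrightarrow> (\<exists>p p'. poly_pair R p p' \<and> p \<noteq> 0 \<and> poly p x = 0 \<and> degree p = m)" for m
  obtain p where p: "p \<noteq> 0" "\<And>j. coeff p j \<in> Domain R" "poly p x = 0"
    using alg unfolding algebraic_over_def by blast
  obtain p' where "poly_pair R p p'" using poly_pair_lift[OF dr p(2)] .
  then have "P (degree p)" using p unfolding P_def by blast
  then obtain L where L: "L = Least P" "P L" by (blast intro: LeastI)
  then obtain mu mu' where mu: "poly_pair R mu mu'" "mu \<noteq> 0" "poly mu x = 0" "degree mu = L"
    unfolding P_def by blast
  have small: "q = 0" if "poly_pair R q q'" "poly q x = 0" "degree q < degree mu" for q q'
  proof (rule ccontr)
    assume "q \<noteq> 0"
    then have "P (degree q)" unfolding P_def using that(1,2) by blast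
    then have "Least P \<le> degree q" by (rule Least_le)
    with that(3) mu(4) L(1) show False by simp
  qed
  have deg: "degree mu \<noteq> 0"
  proof
    assume "degree mu = 0"
    then obtain c where "mu = [:c:]" by (rule degree_eq_zeroE)
    with mu(2,3) show False by auto
  qed
  have "poly (pderiv mu) x \<noteq> 0"
  proof
    assume *: "poly (pderiv mu) x = 0"
    have "coeff mu i \<in> Domain R" for i using mu(1) unfolding poly_pair_def by blast
    moreover have "is_subfield (Domain R)"
      unfolding is_subfield_def
    proof (intro conjI ballI)
      show "0 \<in> Domain R" "1 \<in> Domain R" using dr unfolding dual_ring_def by blast+
      fix x y assume "x \<in> Domain R" "y \<in> Domain R"
      then obtain b c where "(x, b) \<in> R" "(y, c) \<in> R" by blast
      from derivation_graphD[OF R this]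
      show "x + y \<in> Domain R" "x - y \<in> Domain R" "x * y \<in> Domain R" "x / y \<in> Domain R"
        by blast+
    qed
    ultimately have "coeff (pderiv mu) i \<in> Domain R" for i
      by (rule subfield_coeff_pderiv[rotated])
    then obtain q where "poly_pair R (pderiv mu) q" by (rule poly_pair_lift[OF dr])
    from small[OF this *] deg show False by (simp add: degree_pderiv pderiv_eq_0_iff)
  qed
  define d where "d = - poly mu' x / poly (pderiv mu) x"
  have dmu: "poly mu' x + poly (pderiv mu) x * d = 0"
    using \<open>poly (pderiv mu) x \<noteq> 0\<close> by (simp add: d_def)
  have inM: "coeff mu i \<in> M" "coeff mu' i \<in> M" for i
    using mu(1) dr unfolding poly_pair_def dual_ring_def by blast+
  have "poly mu' x \<in> M" "poly (pderiv mu) x \<in> M"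
    by (intro subfield_poly M inM x subfield_coeff_pderiv)+
  then have "0 - poly mu' x / poly (pderiv mu) x \<in> M" using M unfolding is_subfield_def by blast
  then have d: "d \<in> M" by (simp add: d_def)
  have compat: "poly q' x + poly (pderiv q) x * d = 0" if "poly_pair R q q'" "poly q x = 0" for q q'
    using that
  proof (induction "degree q" arbitrary: q q' rule: less_induct)
    case less
    show ?case
    proof (cases "degree q < degree mu")
      case True
      with small less.prems have "q = 0" by blast
      moreover from this have "q' = 0"
        using less.prems dr by (auto simp: poly_pair_def dual_ring_def intro!: poly_eqI)
      ultimately show ?thesis by simp
    next
      case False
      define e where "e = degree q - degree mu"
      obtain m' where m': "(lead_coeff mu, m') \<in> R" using mu(1) unfolding poly_pair_def by blast
      obtain c' where c': "(lead_coeff q, c') \<in> R" using less.prems unfolding poly_pair_def by blast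
      define A where "A = monom (lead_coeff mu) 0"
      define B where "B = monom (lead_coeff q) e"
      define A' where "A' = monom m' 0"
      define B' where "B' = monom c' e"
      have pp: "poly_pair R A A'" "poly_pair R B B'"
        unfolding A_def A'_def B_def B'_def by (intro poly_pair_monom[OF dr] m' c')+
      \<comment> \<open>A step of pseudo-division by \<open>mu\<close>: cross-multiplying with the
        leading coefficients cancels the top term of \<open>q\<close>, so that induction on the
        degree applies.\<close>
      define q2 where "q2 = A * q - B * mu"
      define q2' where "q2' = (A * q' + q * A') - (B * mu' + mu * B')"
      have pp2: "poly_pair R q2 q2'"
        unfolding q2_def q2'_def
        by (intro poly_pair_arith[OF dr] pp less.prems mu)
      have z: "poly q2 x = 0" using less.prems mu by (simp add: q2_def)
      have dA: "pderiv A = 0" by (simp add: A_def pderiv_monom)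
      \<comment> \<open>The terms with \<open>A'\<close>, \<open>B'\<close> and
        \<open>pderiv B\<close> carry a factor \<open>poly q x\<close> or \<open>poly mu x\<close>,
        which is zero.\<close>
      have "poly q2' x + poly (pderiv q2) x * d = poly A x * (poly q' x + poly (pderiv q) x * d)
          - poly B x * (poly mu' x + poly (pderiv mu) x * d)"
        using less.prems mu
        by (simp add: q2_def q2'_def pderiv_diff pderiv_mult dA algebra_simps)
      then have eq: "poly q2' x + poly (pderiv q2) x * d =
          poly A x * (poly q' x + poly (pderiv q) x * d)" using dmu by simp
      have "poly q2' x + poly (pderiv q2) x * d = 0"
      proof (cases "q2 = 0")
        case True
        then have "q2' = 0"
          using pp2 dr by (auto simp: poly_pair_def dual_ring_def intro!: poly_eqI)
        with True show ?thesis by simp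
      next
        case ne: False
        have "degree q2 \<le> degree q"
          unfolding q2_def
        proof (rule degree_diff_le)
          show "degree (A * q) \<le> degree q"
            using degree_mult_le[of A q] by (simp add: A_def monom_0)
          show "degree (B * mu) \<le> degree q"
            using degree_mult_le[of B mu] degree_monom_le[of "lead_coeff q" e] False
            unfolding B_def e_def by linarith
        qed
        moreover have "coeff q2 (degree q) = 0"
          using False coeff_monom_mult[of "lead_coeff q" e mu "degree q"]
          by (simp add: q2_def A_def B_def monom_0 e_def)
        then have "degree q2 \<noteq> degree q" using ne by (metis leading_coeff_0_iff)
        ultimately show ?thesis using less.hyps[OF _ pp2 z] by simp
      qed
      moreover have "poly A x \<noteq> 0" using mu(2) by (simp add: A_def poly_monom)
      ultimately show ?thesis using eq by simp
    qed
  qed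
  show ?thesis using derivation_graph_adjoin[OF M R x d compat] by blast
qed

text \<open>Only the zero polynomial over \<open>Domain R\<close> vanishes at \<open>x\<close>, so
  there is no relation to respect and \<open>d\<close> is free.\<close>

lemma derivation_graph_adjoin_transcendental:
  assumes M: "is_subfield M" and R: "derivation_graph M R" and x: "x \<in> M" and d: "d \<in> M"
    and tr: "\<not> algebraic_over (Domain R) x"
  shows "\<exists>R'. derivation_graph M R' \<and> R \<subseteq> R' \<and> (x, d) \<in> R'"
proof (rule derivation_graph_adjoin[OF M R x d])
  fix p p' assume p: "poly_pair R p p'" "poly p x = 0"
  have "coeff p i \<in> Domain R" for i using p(1) unfolding poly_pair_def by blast
  with tr p(2) have "p = 0" unfolding algebraic_over_def by blast
  moreover from this have "p' = 0"
    using p(1) R by (auto simp: poly_pair_def derivation_graph_def dual_ring_def intro!: poly_eqI)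
  ultimately show "poly p' x + poly (pderiv p) x * d = 0" by simp
qed

text \<open>Zorn's lemma gives a maximal derivation graph above \<open>R\<close>; by the two
  adjunction lemmas its domain is all of \<open>M\<close>.\<close>

lemma derivation_graph_extend:
  fixes M :: "'b::field_char_0 set"
  assumes M: "is_subfield M" and R: "derivation_graph M R"
  shows "\<exists>D. derivation_on M D \<and> D ` M \<subseteq> M \<and> (\<forall>(x, a)\<in>R. D x = a)"
proof -
  define \<A> where "\<A> = {R'. derivation_graph M R' \<and> R \<subseteq> R'}"
  have "\<exists>Z\<in>\<A>. \<forall>X\<in>\<A>. Z \<subseteq> X \<longrightarrow> X = Z"
  proof (rule subset_Zorn_nonempty)
    show "\<A> \<noteq> {}" using R unfolding \<A>_def by blast
    fix \<C> assume ne: "\<C> \<noteq> {}" and ch: "subset.chain \<A> \<C>"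
    have sub: "derivation_graph M X" "R \<subseteq> X" if "X \<in> \<C>" for X
      using ch that unfolding \<A>_def subset.chain_def by blast+
    \<comment> \<open>The closure conditions involve two pairs at a time, and in a chain both lie in
      a common member.\<close>
    have two: "\<exists>X\<in>\<C>. z \<in> X \<and> w \<in> X" if "z \<in> \<Union>\<C>" "w \<in> \<Union>\<C>" for z w
      using ch that unfolding subset.chain_def by blast
    have cl: "(x + y, a + b) \<in> \<Union>\<C> \<and> (x - y, a - b) \<in> \<Union>\<C> \<and> (x * y, x * b + y * a) \<in> \<Union>\<C> \<and>
        (x / y, (a * y - x * b) / y\<^sup>2) \<in> \<Union>\<C>" if xy: "(x, a) \<in> \<Union>\<C>" "(y, b) \<in> \<Union>\<C>" for x a y b
    proof -
      obtain X where X: "X \<in> \<C>" "(x, a) \<in> X" "(y, b) \<in> X" using two[OF xy] by blast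
      from derivation_graphD[OF sub(1)[OF X(1)] X(2,3)] X(1) show ?thesis by blast
    qed
    have el: "X \<subseteq> M \<times> M" "(0, 0) \<in> X" "(1, 0) \<in> X" "\<And>a. (0, a) \<in> X \<Longrightarrow> a = 0" if "X \<in> \<C>" for X
      using sub(1)[OF that] unfolding derivation_graph_def dual_ring_def by blast+
    obtain X where X: "X \<in> \<C>" using ne by blast
    have "\<Union>\<C> \<subseteq> M \<times> M" using el(1) by blast
    moreover have "(0, 0) \<in> \<Union>\<C>" "(1, 0) \<in> \<Union>\<C>" "R \<subseteq> \<Union>\<C>" using el(2,3)[OF X] sub(2)[OF X] X by blast+
    moreover have "\<And>a. (0, a) \<in> \<Union>\<C> \<Longrightarrow> a = 0" using el(4) by blast
    ultimately show "\<Union>\<C> \<in> \<A>"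
      unfolding \<A>_def derivation_graph_def dual_ring_def mem_Collect_eq using cl by blast
  qed
  then obtain Z where Z: "derivation_graph M Z" "R \<subseteq> Z"
    and max: "\<And>X. derivation_graph M X \<Longrightarrow> Z \<subseteq> X \<Longrightarrow> X = Z"
    unfolding \<A>_def by (smt (verit) mem_Collect_eq order_trans)
  have dom: "x \<in> Domain Z" if "x \<in> M" for x
  proof (cases "algebraic_over (Domain Z) x")
    case True
    from derivation_graph_adjoin_algebraic[OF M Z(1) that True] max show ?thesis by blast
  next
    case False
    from derivation_graph_adjoin_transcendental[OF M Z(1) that that False] max show ?thesis by blast
  qed
  have dr: "dual_ring M Z" using Z(1) unfolding derivation_graph_def by blast
  define D where "D x = (THE a. (x, a) \<in> Z)" for x
  have D: "D x = a" if "(x, a) \<in> Z" for x a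
    unfolding D_def using that dual_ring_unique[OF dr] by blast
  have DZ: "(x, D x) \<in> Z" if "x \<in> M" for x using dom[OF that] D by auto
  have "derivation_on M D"
    unfolding derivation_on_def
  proof (intro ballI conjI)
    fix x y assume "x \<in> M" "y \<in> M"
    then have "(x + y, D x + D y) \<in> Z" "(x * y, x * D y + y * D x) \<in> Z"
      using DZ dr unfolding dual_ring_def by blast+
    then show "D (x + y) = D x + D y" "D (x * y) = x * D y + y * D x" using D by blast+
  qed
  moreover have "D ` M \<subseteq> M" using DZ dr unfolding dual_ring_def by blast
  moreover have "\<forall>(x, a)\<in>R. D x = a" using D Z(2) by blast
  ultimately show ?thesis by blast
qed

lemma derivation_on_zero_one:
  assumes "is_subfield E" "derivation_on E D"
  shows "D 0 = 0" "D 1 = 0"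
proof -
  have "D (0 + 0) = D 0 + D 0" "D (1 * 1) = 1 * D 1 + 1 * D 1"
    using assms unfolding derivation_on_def is_subfield_def by blast+
  then have "D 0 = D 0 + D 0" "D 1 = D 1 + D 1" by (simp_all only: add_0 mult_1)
  then show "D 0 = 0" "D 1 = 0" by (simp_all only: add_cancel_right_right)
qed

lemma derivation_graph_of:
  assumes E: "is_subfield E" and D: "derivation_on E D" and "D ` E \<subseteq> M" "E \<subseteq> M"
  shows "derivation_graph M {(x, D x) | x. x \<in> E}"
proof -
  note D01 = derivation_on_zero_one[OF E D]
  have Dp: "D (x + y) = D x + D y" "D (x * y) = x * D y + y * D x" if "x \<in> E" "y \<in> E" for x y
    using D that unfolding derivation_on_def by blast+
  have Ep: "x + y \<in> E" "x - y \<in> E" "x * y \<in> E" "x / y \<in> E" if "x \<in> E" "y \<in> E" for x y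
    using E that unfolding is_subfield_def by blast+
  have E01: "0 \<in> E" "1 \<in> E" using E unfolding is_subfield_def by blast+
  have Dm: "D (x - y) = D x - D y" if "x \<in> E" "y \<in> E" for x y
    using Dp(1)[OF Ep(2)[OF that] that(2)] by simp
  have Dd: "D (x / y) = (D x * y - x * D y) / y\<^sup>2" if "x \<in> E" "y \<in> E" for x y
  proof (cases "y = 0")
    case False
    have "D x = (x / y) * D y + y * D (x / y)"
      using Dp(2)[OF Ep(4)[OF that] that(2)] False by simp
    then show ?thesis using False by (simp add: field_simps power2_eq_square)
  qed (simp add: D01)
  show ?thesis
    unfolding derivation_graph_def dual_ring_def
    using assms(3,4) E01 D01 by (auto simp: Dp Dm Dd Ep)
qed

text \<open>The source of nonzero derivations: the value at one transcendental element is
  prescribed, then the derivation is extended to the whole field.\<close>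

lemma derivation_extend:
  fixes M :: "'b::field_char_0 set"
  assumes "is_subfield M" "is_subfield E" "E \<subseteq> M" "derivation_on E D0" "D0 ` E \<subseteq> M"
    and "x \<in> M" "d \<in> M" "\<not> algebraic_over E x"
  obtains D where "derivation_on M D" "D ` M \<subseteq> M" "\<And>y. y \<in> E \<Longrightarrow> D y = D0 y" "D x = d"
proof -
  have "derivation_graph M {(x, D0 x) | x. x \<in> E}"
    by (rule derivation_graph_of) (use assms in auto)
  moreover have "Domain {(x, D0 x) | x. x \<in> E} = E" by auto
  ultimately have "\<exists>R'. derivation_graph M R' \<and> {(x, D0 x) | x. x \<in> E} \<subseteq> R' \<and> (x, d) \<in> R'"
    using assms by (intro derivation_graph_adjoin_transcendental) simp_all
  then obtain R' where R': "derivation_graph M R'" "{(x, D0 x) | x. x \<in> E} \<subseteq> R'" "(x, d) \<in> R'"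
    by blast
  from derivation_graph_extend[OF assms(1) R'(1)] obtain D where
    D: "derivation_on M D" "D ` M \<subseteq> M" "\<forall>(x, a)\<in>R'. D x = a" by blast
  show ?thesis
    by (rule that[of D]) (use D R' in auto)
qed

lemma derivation_poly:
  assumes "derivation_on UNIV D" "\<And>i. D (coeff p i) = 0"
  shows "D (poly p x) = poly (pderiv p) x * D x"
  using assms(2)
proof (induction p)
  case 0
  then show ?case using assms(1) derivation_on_zero_one[of UNIV D] by (simp add: is_subfield_def)
next
  case (pCons a p)
  have "D a = 0" "\<And>i. D (coeff p i) = 0"
    using pCons.prems[of 0] pCons.prems[of "Suc _"] by simp_all
  then show ?case
    using assms(1) pCons.IH by (simp add: derivation_on_def pderiv_pCons algebra_simps)
qed

text \<open>Applying \<open>D\<close> to \<open>poly p x = 0\<close> gives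
  \<open>poly (pderiv p) x * D x = 0\<close>. Either \<open>D x = 0\<close>, or
  \<open>pderiv p\<close> is a nonzero annihilating polynomial of smaller degree, and induction
  applies.\<close>

lemma derivation_algebraic:
  fixes D :: "'b::field_char_0 \<Rightarrow> 'b"
  assumes D: "derivation_on UNIV D" and E: "is_subfield E" "\<And>y. y \<in> E \<Longrightarrow> D y = 0"
    and alg: "algebraic_over E x"
  shows "D x = 0"
proof -
  obtain p where "p \<noteq> 0" "\<forall>j. coeff p j \<in> E" "poly p x = 0"
    using alg unfolding algebraic_over_def by blast
  then show ?thesis
  proof (induction "degree p" arbitrary: p rule: less_induct)
    case less
    have deg: "degree p \<noteq> 0"
    proof
      assume "degree p = 0"
      then obtain c where "p = [:c:]" by (rule degree_eq_zeroE)
      with less.prems show False by auto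
    qed
    have "0 = D (poly p x)"
      using less.prems derivation_on_zero_one[of UNIV D] D by (simp add: is_subfield_def)
    also have "\<dots> = poly (pderiv p) x * D x"
      by (rule derivation_poly[OF D]) (use E less.prems in blast)
    finally consider "poly (pderiv p) x = 0" | "D x = 0" by auto
    then show ?case
    proof cases
      case 1
      have "pderiv p \<noteq> 0" "degree (pderiv p) < degree p"
        using deg by (auto simp: pderiv_eq_0_iff degree_pderiv)
      then show ?thesis
        using less.hyps[of "pderiv p"] 1 subfield_coeff_pderiv[OF E(1)] less.prems by blast
    qed
  qed
qed

section \<open>Polynomial expressions\<close>

text \<open>For expressions, unlike for finitely supported maps, formal partial derivatives and the chain
  rule are structural recursions and inductions.\<close>

datatype 'a pexp = Cst 'a | Ind var | Add "'a pexp" "'a pexp" | Mul "'a pexp" "'a pexp"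

primrec peval :: "(var \<Rightarrow> 'a::comm_ring_1 poly fps) \<Rightarrow> 'a pexp \<Rightarrow> 'a poly fps" where
  "peval x (Cst c) = fps_scalar c"
| "peval x (Ind v) = x v"
| "peval x (Add e f) = peval x e + peval x f"
| "peval x (Mul e f) = peval x e * peval x f"

primrec pvars :: "'a pexp \<Rightarrow> var set" where
  "pvars (Cst c) = {}"
| "pvars (Ind v) = {v}"
| "pvars (Add e f) = pvars e \<union> pvars f"
| "pvars (Mul e f) = pvars e \<union> pvars f"

primrec pdiff :: "var \<Rightarrow> 'a::comm_ring_1 pexp \<Rightarrow> 'a pexp" where
  "pdiff v (Cst c) = Cst 0"
| "pdiff v (Ind w) = Cst (if v = w then 1 else 0)"
| "pdiff v (Add e f) = Add (pdiff v e) (pdiff v f)"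
| "pdiff v (Mul e f) = Add (Mul e (pdiff v f)) (Mul f (pdiff v e))"

lemma pvars_pdiff: "pvars (pdiff v e) \<subseteq> pvars e"
  by (induction e) auto

lemma fps_scalar_simps [simp]: "fps_scalar 0 = 0" "fps_scalar 1 = 1"
  by (simp_all add: fps_scalar_def flip: one_pCons)

text \<open>Closure under sums and products lets \<open>subst_mpoly\<close> be converted along its
  defining formula, with one expression serving all \<open>x\<close>.\<close>

definition polynomial_map :: "var set \<Rightarrow> ((var \<Rightarrow> 'a::comm_ring_1 poly fps) \<Rightarrow> 'a poly fps) \<Rightarrow> bool" where
  "polynomial_map V g \<longleftrightarrow> (\<exists>e. pvars e \<subseteq> V \<and> (\<forall>x. g x = peval x e))"

lemma polynomial_map_scalar: "polynomial_map V (\<lambda>x. fps_scalar c)"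
  unfolding polynomial_map_def by (intro exI[of _ "Cst c"]) simp

lemma polynomial_map_var: "v \<in> V \<Longrightarrow> polynomial_map V (\<lambda>x. x v)"
  unfolding polynomial_map_def by (intro exI[of _ "Ind v"]) simp

lemma polynomial_map_add:
  "polynomial_map V g \<Longrightarrow> polynomial_map V h \<Longrightarrow> polynomial_map V (\<lambda>x. g x + h x)"
  unfolding polynomial_map_def by (metis le_sup_iff peval.simps(3) pvars.simps(3))

lemma polynomial_map_mult:
  "polynomial_map V g \<Longrightarrow> polynomial_map V h \<Longrightarrow> polynomial_map V (\<lambda>x. g x * h x)"
  unfolding polynomial_map_def by (metis le_sup_iff peval.simps(4) pvars.simps(4))

lemma polynomial_map_power: "polynomial_map V g \<Longrightarrow> polynomial_map V (\<lambda>x. g x ^ m)"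
  using polynomial_map_scalar[of V 1] by (induction m) (auto intro: polynomial_map_mult)

lemma polynomial_map_sum:
  "(\<And>i. i \<in> I \<Longrightarrow> polynomial_map V (g i)) \<Longrightarrow> polynomial_map V (\<lambda>x. \<Sum>i\<in>I. g i x)"
  using polynomial_map_scalar[of V 0]
  by (induction I rule: infinite_finite_induct) (auto intro: polynomial_map_add)

lemma polynomial_map_prod:
  "(\<And>i. i \<in> I \<Longrightarrow> polynomial_map V (g i)) \<Longrightarrow> polynomial_map V (\<lambda>x. \<Prod>i\<in>I. g i x)"
  using polynomial_map_scalar[of V 1]
  by (induction I rule: infinite_finite_induct) (auto intro: polynomial_map_mult)

lemma subst_mpoly_pexp: "\<exists>e. pvars e \<subseteq> indets Q \<and> (\<forall>x. subst_mpoly x Q = peval x e)"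
proof -
  have "polynomial_map (indets Q) (\<lambda>x. subst_mpoly x Q)"
    unfolding subst_mpoly_def
    by (intro polynomial_map_sum polynomial_map_mult polynomial_map_scalar polynomial_map_prod
        polynomial_map_power polynomial_map_var) (auto simp: indets_def)
  then show ?thesis unfolding polynomial_map_def .
qed

lemma peval_cong: "(\<And>v. v \<in> pvars e \<Longrightarrow> x v = y v) \<Longrightarrow> peval x e = peval y e"
  by (induction e) auto

text \<open>Polynomials respect congruences. The moduli used later are \<open>fps_X ^ m\<close>,
  \<open>W\<^sup>2\<close> and \<open>W\<close>.\<close>

lemma dvd_peval_diff:
  "(\<And>v. v \<in> pvars e \<Longrightarrow> d dvd x v - y v) \<Longrightarrow> d dvd peval x e - peval y e"
proof (induction e)
  case (Add e f)
  then have "d dvd (peval x e - peval y e) + (peval x f - peval y f)"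
    by (intro dvd_add) auto
  then show ?case by (simp add: algebra_simps)
next
  case (Mul e f)
  then have "d dvd (peval x e - peval y e) * peval x f + peval y e * (peval x f - peval y f)"
    by (intro dvd_add dvd_mult dvd_mult2) auto
  then show ?case by (simp add: algebra_simps)
qed auto

text \<open>The chain rule. \<open>V\<close> may exceed the variables of \<open>e\<close>, because
  the additional partial derivatives evaluate to zero.\<close>

lemma derivation_peval:
  fixes x :: "var \<Rightarrow> 'a::field poly fps"
  assumes D: "derivation_on UNIV D" and D0: "\<And>c. D (to_fract (fps_scalar c)) = 0"
    and V: "finite V" "pvars e \<subseteq> V"
  shows "D (to_fract (peval x e)) = (\<Sum>v\<in>V. to_fract (peval x (pdiff v e)) * D (to_fract (x v)))"
  using V(2)
proof (induction e)
  case (Cst c)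
  then show ?case by (simp add: D0)
next
  case (Ind w)
  have "(\<Sum>v\<in>V. to_fract (peval x (pdiff v (Ind w))) * D (to_fract (x v))) =
     (\<Sum>v\<in>V. if v = w then D (to_fract (x v)) else 0)"
    by (intro sum.cong) auto
  then show ?case using Ind V(1) by simp
next
  case (Add e f)
  then show ?case using D by (simp add: derivation_on_def sum.distrib algebra_simps)
next
  case (Mul e f)
  then show ?case using D by (simp add: derivation_on_def sum.distrib sum_distrib_left algebra_simps)
qed

section \<open>Division in the ring of power series with polynomial coefficients\<close>

lemma eval_u_nth [simp]: "eval_u c A $ m = [:poly (A $ m) c:]"
  by (simp add: eval_u_def)

lemma const_poly_sum: "(\<Sum>i\<in>I. [:g i:]) = [:sum g I:]"
  by (induction I rule: infinite_finite_induct) auto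

lemma eval_u_ring [simp]:
  "eval_u c (A + B) = eval_u c A + eval_u c B" "eval_u c (A - B) = eval_u c A - eval_u c B"
  "eval_u c (A * B) = eval_u c A * eval_u c B" "eval_u c 1 = 1" "eval_u c 0 = 0"
  by (auto intro!: fps_ext simp: fps_mult_nth poly_sum const_poly_sum one_pCons mult.commute)

text \<open>Inside \<open>\<bbbK>[u][[t]]\<close>, the set \<open>zseries\<close> is \<open>\<bbbK>[[t]]\<close>, and \<open>useries\<close> below is \<open>\<bbbK>[[t]][u]\<close>;
  later, \<open>zfield\<close> is \<open>\<bbbK>((t))\<close>.\<close>

definition zseries :: "'a::field poly fps set" where
  "zseries = {A. \<forall>m. degree (A $ m) = 0}"

text \<open>A polynomial is constant exactly when it equals its value at one point, and any point
  \<open>c\<close> will do.\<close>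

lemma zseries_iff: "A \<in> zseries \<longleftrightarrow> eval_u c A = A"
proof -
  have "degree p = 0 \<longleftrightarrow> [:poly p c:] = p" for p :: "'a poly"
    by (metis degree_eq_zeroE degree_pCons_0 mult_zero_right poly_pCons add.right_neutral poly_0)
  then show ?thesis by (simp add: zseries_def fps_eq_iff)
qed

lemma eval_u_zseries [simp]: "eval_u c A \<in> zseries"
  by (simp add: zseries_def)

lemma eval_u_eval_u [simp]: "eval_u c (eval_u d A) = eval_u d A"
  by (auto intro: fps_ext)

definition is_subring :: "'b::comm_ring_1 set \<Rightarrow> bool" where
  "is_subring R \<longleftrightarrow> 0 \<in> R \<and> 1 \<in> R \<and> (\<forall>x\<in>R. \<forall>y\<in>R. x + y \<in> R \<and> x - y \<in> R \<and> x * y \<in> R)"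

lemma subring_zseries: "is_subring zseries"
  by (simp add: is_subring_def zseries_iff[of _ 0])

lemma fps_X_zseries: "fps_X \<in> zseries"
  by (simp add: zseries_def fps_X_def)

lemma fps_scalar_zseries: "fps_scalar c \<in> zseries"
  by (simp add: zseries_def fps_scalar_def)

definition u_minus :: "'a::field \<Rightarrow> 'a poly fps" where "u_minus c = fps_u - fps_scalar c"

lemma u_minus_eq: "u_minus c = fps_const [:-c, 1:]"
  by (simp add: u_minus_def fps_u_def fps_scalar_def)

lemma u_minus_nonzero [simp]: "u_minus c \<noteq> 0"
  by (simp add: u_minus_eq)

lemma eval_u_u_minus [simp]: "eval_u c (u_minus c) = 0"
  by (auto intro!: fps_ext simp: u_minus_eq)

lemma u_minus_Delta: "u_minus c * Delta c A = A - eval_u c A"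
  unfolding u_minus_def by (rule Delta_mult)

text \<open>Evaluation at \<open>u = c\<close> kills the left-hand side and fixes \<open>E\<close>,
  which identifies \<open>E\<close>; then \<open>u - c\<close> is cancelled. This is how divided
  differences are recognised later.\<close>

lemma Delta_unique:
  assumes "u_minus c * B = A - E" "E \<in> zseries"
  shows "E = eval_u c A" "B = Delta c A"
proof -
  have "eval_u c (u_minus c * B) = eval_u c A - eval_u c E" by (simp add: assms(1))
  then show E: "E = eval_u c A" using assms(2) by (simp add: zseries_iff[of _ c])
  show "B = Delta c A" using assms(1) u_minus_Delta[of c A] E by (metis mult_left_cancel u_minus_nonzero)
qed

lemma Delta_diff [simp]: "Delta c (A - B) = Delta c A - Delta c B"
  using Delta_unique(2)[of c "Delta c A - Delta c B" "A - B" "eval_u c A - eval_u c B"] eval_u_zseries[of c "A - B"]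
  by (simp add: right_diff_distrib u_minus_Delta)

lemma Delta_zmult:
  assumes "Z \<in> zseries"
  shows "Delta c (Z * A) = Z * Delta c A"
proof -
  have "u_minus c * (Z * Delta c A) = Z * (A - eval_u c A)"
    by (simp flip: u_minus_Delta add: mult_ac)
  also have "\<dots> = Z * A - eval_u c (Z * A)"
    using assms by (simp add: zseries_iff[of _ c] right_diff_distrib)
  finally show ?thesis using Delta_unique(2)[OF _ eval_u_zseries] by metis
qed

lemma Delta_u_minus: "Delta c (u_minus c * A) = A"
  by (rule sym, rule Delta_unique(2)[where E = 0]) (simp_all add: zseries_def)

lemma Delta_pow_diff: "(Delta c ^^ l) (A - B) = (Delta c ^^ l) A - (Delta c ^^ l) B"
  by (induction l) auto

text \<open>Each \<open>Delta c\<close> removes one factor \<open>u - c\<close>. So a change by a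
  multiple of \<open>(u - c)^k\<close> changes the first \<open>k\<close> divided differences only
  by multiples of \<open>u - c\<close>.\<close>

lemma Delta_pow_u_minus: "l \<le> k \<Longrightarrow> (Delta c ^^ l) (u_minus c ^ k * A) = u_minus c ^ (k - l) * A"
proof (induction l)
  case (Suc l)
  then have "k - l = Suc (k - Suc l)" by simp
  with Suc show ?case by (simp add: Delta_u_minus mult.assoc)
qed simp

lemma fps_X_power_zseries: "fps_X ^ m \<in> zseries"
  using subring_zseries fps_X_zseries by (induction m) (auto simp: is_subring_def)

lemma fps_X_dvd_Delta_pow: "fps_X ^ m dvd A \<Longrightarrow> fps_X ^ m dvd (Delta c ^^ l) A"
  by (induction l) (auto elim!: dvdE simp: Delta_zmult fps_X_power_zseries)

text \<open>Taylor's formula at \<open>u = c\<close>: \<open>eval_u c ((Delta c ^^ m) A)\<close> is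
  the coefficient of \<open>(u - c)^m\<close>, and the left-hand side is the remainder.\<close>

lemma u_minus_pow_Delta_pow:
  "u_minus c ^ l * (Delta c ^^ l) A = A - (\<Sum>m<l. eval_u c ((Delta c ^^ m) A) * u_minus c ^ m)"
proof (induction l)
  case (Suc l)
  have "u_minus c ^ Suc l * (Delta c ^^ Suc l) A = u_minus c ^ l * (u_minus c * Delta c ((Delta c ^^ l) A))"
    by simp
  also have "\<dots> = u_minus c ^ l * (Delta c ^^ l) A - eval_u c ((Delta c ^^ l) A) * u_minus c ^ l"
    by (simp add: u_minus_Delta algebra_simps)
  finally show ?case using Suc by simp
qed simp

lemma fps_eq_0_if_X_dvd:
  fixes A :: "'b::comm_ring_1 fps"
  assumes "\<And>m. fps_X ^ m dvd A"
  shows "A = 0"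
proof (rule fps_ext)
  fix m
  obtain B where "A = fps_X ^ Suc m * B" using assms[of "Suc m"] by (elim dvdE)
  then show "A $ m = 0 $ m" by (simp add: fps_X_power_mult_nth del: power_Suc)
qed

section \<open>Series that are polynomial in u\<close>

definition useries :: "'a::field poly fps set" where
  "useries = {A. \<exists>B. \<forall>m. degree (A $ m) \<le> B}"

lemma zseries_useries: "A \<in> zseries \<Longrightarrow> A \<in> useries"
  by (auto simp: zseries_def useries_def)

lemma subring_useries: "is_subring useries"
  unfolding is_subring_def
proof (intro conjI ballI)
  show "0 \<in> useries" "1 \<in> useries" using zseries_useries subring_zseries unfolding is_subring_def by blast+
  fix x y :: "'a poly fps" assume "x \<in> useries" "y \<in> useries"
  then obtain B C where *: "\<And>m. degree (x $ m) \<le> B" "\<And>m. degree (y $ m) \<le> C"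
    unfolding useries_def by auto
  have "degree ((x + y) $ m) \<le> max B C" "degree ((x - y) $ m) \<le> max B C" for m
    using *[of m] by (auto intro!: degree_add_le degree_diff_le)
  then show "x + y \<in> useries" "x - y \<in> useries" unfolding useries_def by blast+
  have "degree ((x * y) $ m) \<le> B + C" for m
    unfolding fps_mult_nth
    by (intro degree_sum_le) (auto intro!: order_trans[OF degree_mult_le] add_mono *)
  then show "x * y \<in> useries" unfolding useries_def by blast
qed

lemma fps_const_useries: "fps_const p \<in> useries"
  unfolding useries_def by (auto intro!: exI[of _ "degree p"])

text \<open>Multiplication by \<open>u - c\<close> raises the degree of a nonzero polynomial, so a
  degree bound for \<open>A\<close> is also one for \<open>Delta c A\<close>.\<close>

lemma Delta_useries: "A \<in> useries \<Longrightarrow> Delta c A \<in> useries"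
proof -
  assume "A \<in> useries"
  then obtain B where B: "\<And>m. degree (A $ m) \<le> B" unfolding useries_def by blast
  have "degree (Delta c A $ m) \<le> B" for m
  proof -
    have "[:-c, 1:] * (Delta c A $ m) = A $ m - [:poly (A $ m) c:]"
      using arg_cong[OF u_minus_Delta[of c A], of "\<lambda>x. x $ m"] by (simp add: u_minus_eq)
    moreover have "degree (A $ m - [:poly (A $ m) c:]) \<le> B"
      using B by (intro degree_diff_le) auto
    ultimately have "degree ([:-c, 1:] * (Delta c A $ m)) \<le> B" by metis
    then show ?thesis
      by (cases "Delta c A $ m = 0") (simp_all add: degree_mult_eq del: mult_pCons_left)
  qed
  then show ?thesis unfolding useries_def by blast
qed

lemma useries_expand:
  assumes "A \<in> useries"
  obtains B z where "\<And>l. z l \<in> zseries" "A = (\<Sum>l\<le>B. z l * fps_u ^ l)"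
proof -
  obtain B where B: "\<And>m. degree (A $ m) \<le> B" using assms unfolding useries_def by blast
  define z where "z l = Abs_fps (\<lambda>m. [:coeff (A $ m) l:])" for l
  have "A = (\<Sum>l\<le>B. z l * fps_u ^ l)"
  proof (rule fps_ext)
    fix m
    have "(\<Sum>l\<le>B. z l * fps_u ^ l) $ m = (\<Sum>l\<le>B. monom (coeff (A $ m) l) l)"
      by (simp add: fps_sum_nth fps_u_def fps_const_power z_def monom_altdef)
    also have "\<dots> = A $ m"
      using B by (rule poly_as_sum_of_monoms')
    finally show "A $ m = (\<Sum>l\<le>B. z l * fps_u ^ l) $ m" by simp
  qed
  moreover have "z l \<in> zseries" for l by (simp add: z_def zseries_def)
  ultimately show ?thesis using that by blast
qed

section \<open>Weierstrass division\<close>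

fun weierstrass_quotient :: "'a::field poly fps \<Rightarrow> 'a poly fps \<Rightarrow> nat \<Rightarrow> 'a poly" where
  "weierstrass_quotient d A m = (A $ m - (\<Sum>i\<in>{..<m}. weierstrass_quotient d A i * d $ (m - i))) div d $ 0"

declare weierstrass_quotient.simps [simp del]

text \<open>With the lower coefficients of \<open>q\<close> known, Euclidean division by
  \<open>d $ 0\<close> yields the next coefficient of \<open>q\<close> and, as its remainder, that
  of \<open>r\<close>.\<close>

lemma weierstrass_division:
  fixes A d :: "'a::field poly fps"
  assumes "d $ 0 \<noteq> 0"
  obtains q r where "A = d * q + r" "\<And>m. r $ m = 0 \<or> degree (r $ m) < degree (d $ 0)"
proof -
  define q where "q = Abs_fps (weierstrass_quotient d A)"
  define r where "r = A - d * q"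
  have "r $ m = 0 \<or> degree (r $ m) < degree (d $ 0)" for m
  proof -
    define S where "S = A $ m - (\<Sum>i<m. weierstrass_quotient d A i * d $ (m - i))"
    have "(d * q) $ m = (\<Sum>i\<le>m. weierstrass_quotient d A i * d $ (m - i))"
      by (subst mult.commute) (simp add: fps_mult_nth q_def atLeast0AtMost)
    also have "\<dots> = (\<Sum>i<m. weierstrass_quotient d A i * d $ (m - i)) + weierstrass_quotient d A m * d $ 0"
      by (simp add: lessThan_Suc_atMost[symmetric])
    also have "weierstrass_quotient d A m = S div d $ 0"
      by (subst weierstrass_quotient.simps) (simp add: S_def)
    finally have "r $ m = S - (S div d $ 0) * d $ 0" by (simp add: r_def S_def)
    then have "r $ m = S mod d $ 0" by (simp add: minus_div_mult_eq_mod)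
    then show ?thesis using degree_mod_less[OF assms, of S] by simp
  qed
  then show ?thesis using that[of q r] by (simp add: r_def)
qed

text \<open>The coefficient of \<open>u^N\<close> is a series in t with nonzero constant term. So
  \<open>W\<close> is a unit of K[[t]] times a monic polynomial in u of degree
  \<open>N\<close>.\<close>

definition umonic :: "nat \<Rightarrow> 'a::field poly fps \<Rightarrow> bool" where
  "umonic N W \<longleftrightarrow> W $ 0 \<noteq> 0 \<and> degree (W $ 0) = N \<and> (\<forall>m. degree (W $ m) \<le> N)"

lemma umonic_mult: "umonic M A \<Longrightarrow> umonic N B \<Longrightarrow> umonic (M + N) (A * B)"
  unfolding umonic_def
  by (auto simp: degree_mult_eq fps_mult_nth intro!: degree_sum_le order_trans[OF degree_mult_le] add_mono)

lemma umonic_u_minus_pow: "umonic k (u_minus c ^ k)"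
proof (induction k)
  case (Suc k)
  have "umonic 1 (u_minus c)" by (auto simp: umonic_def u_minus_eq)
  from umonic_mult[OF this Suc] show ?case by simp
qed (auto simp: umonic_def)

lemma umonic_useries: "umonic N A \<Longrightarrow> A \<in> useries"
  unfolding umonic_def useries_def by blast

text \<open>Up to products with earlier coefficients of \<open>h\<close>,
  \<open>W $ 0 * h $ m\<close> is a coefficient of \<open>W * h\<close>. By induction its degree is
  at most \<open>N + B\<close>, while \<open>W $ 0\<close> has degree exactly
  \<open>N\<close>.\<close>

lemma umonic_quotient:
  assumes W: "umonic N W" and "W * h \<in> useries"
  shows "h \<in> useries"
proof -
  obtain B where B: "\<And>m. degree ((W * h) $ m) \<le> B" using assms(2) unfolding useries_def by blast
  have "degree (h $ m) \<le> B" for m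
  proof (induction m rule: less_induct)
    case (less m)
    have "(W * h) $ m = (\<Sum>i=0..m. W $ i * h $ (m - i))" by (simp add: fps_mult_nth)
    also have "\<dots> = W $ 0 * h $ m + (\<Sum>i=Suc 0..m. W $ i * h $ (m - i))"
      by (subst sum.atLeast_Suc_atMost) auto
    finally have eq: "W $ 0 * h $ m = (W * h) $ m - (\<Sum>i=Suc 0..m. W $ i * h $ (m - i))" by simp
    have "degree (\<Sum>i=Suc 0..m. W $ i * h $ (m - i)) \<le> N + B"
      using W less by (intro degree_sum_le)
        (auto simp: umonic_def intro!: order_trans[OF degree_mult_le] add_mono)
    then have "degree (W $ 0 * h $ m) \<le> N + B"
      unfolding eq using B[of m] by (intro degree_diff_le) auto
    then show ?case
      using W by (cases "h $ m = 0") (auto simp: umonic_def degree_mult_eq)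
  qed
  then show ?thesis unfolding useries_def by blast
qed

lemma umonic_division:
  assumes W: "umonic N W"
  obtains q r where "A = W * q + r" "r \<in> useries"
proof -
  obtain q r where qr: "A = W * q + r" "\<And>m. r $ m = 0 \<or> degree (r $ m) < degree (W $ 0)"
    using weierstrass_division[of W A] W unfolding umonic_def by blast
  have "degree (r $ m) \<le> degree (W $ 0)" for m using qr(2)[of m] by auto
  then show ?thesis using that[OF qr(1)] unfolding useries_def by blast
qed

text \<open>Dividing \<open>(u - c)^N\<close> by \<open>d\<close> leaves a remainder whose nonzero
  coefficients have degree below \<open>N\<close>. Hence \<open>d * q = (u - c)^N - r\<close> keeps
  the leading term \<open>u^N\<close>.\<close>

lemma umonic_multiple_exists:
  assumes d: "d $ 0 = [:-c, 1:] ^ N"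
  obtains q where "umonic N (d * q)"
proof -
  obtain q r where qr: "u_minus c ^ N = d * q + r" "\<And>m. r $ m = 0 \<or> degree (r $ m) < degree (d $ 0)"
    using weierstrass_division[of d "u_minus c ^ N"] d by (metis pCons_eq_0_iff power_not_zero zero_neq_one)
  have deg: "degree (d $ 0) = N" using d by (simp add: degree_power_eq)
  have m: "umonic N (u_minus c ^ N)" by (rule umonic_u_minus_pow)
  have dq: "d * q = u_minus c ^ N - r" using qr(1) by simp
  have le: "degree (r $ m) \<le> N" for m using qr(2)[of m] deg by auto
  have "degree (u_minus c ^ N $ 0 - r $ 0) = N \<and> u_minus c ^ N $ 0 - r $ 0 \<noteq> 0"
  proof (cases "r $ 0 = 0")
    case False
    then have "degree (- (r $ 0)) < degree (u_minus c ^ N $ 0)" using qr(2)[of 0] m deg by (auto simp: umonic_def)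
    then have "degree (- (r $ 0) + u_minus c ^ N $ 0) = degree (u_minus c ^ N $ 0)" by (rule degree_add_eq_right)
    then have "degree (u_minus c ^ N $ 0 - r $ 0) = N" using m by (simp add: umonic_def)
    moreover from False have "N > 0" using qr(2)[of 0] deg by auto
    ultimately show ?thesis by auto
  qed (use m in \<open>auto simp: umonic_def\<close>)
  moreover have "degree (u_minus c ^ N $ m - r $ m) \<le> N" for m
    using m le by (intro degree_diff_le) (auto simp: umonic_def)
  ultimately show ?thesis using that[of q] unfolding umonic_def dq by simp
qed

section \<open>Derivations of the fraction field\<close>

instance fps :: (ring_char_0) ring_char_0 ..

instance fract :: ("{idom,ring_char_0}") field_char_0
proof
  show "inj (of_nat :: nat \<Rightarrow> 'a fract)"
  proof (rule injI)
    fix m n assume "(of_nat m :: 'a fract) = of_nat n"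
    then have "to_fract (of_nat m :: 'a) = to_fract (of_nat n)" by (simp add: of_nat_fract Fract_conv_to_fract)
    then show "m = n" by simp
  qed
qed

section \<open>Rings of fractions with prescribed numerators and denominators\<close>

definition fractions :: "'b::idom set \<Rightarrow> 'b set \<Rightarrow> 'b fract set" where
  "fractions B C = {to_fract p / to_fract q | p q. p \<in> B \<and> q \<in> C \<and> q \<noteq> 0}"

lemma fractionsI: "p \<in> B \<Longrightarrow> q \<in> C \<Longrightarrow> q \<noteq> 0 \<Longrightarrow> x = to_fract p / to_fract q \<Longrightarrow> x \<in> fractions B C"
  unfolding fractions_def by blast

lemma to_fract_fractions: "is_subring C \<Longrightarrow> p \<in> B \<Longrightarrow> to_fract p \<in> fractions B C"
  by (rule fractionsI[of p _ 1]) (auto simp: is_subring_def)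

lemma subring_fractions:
  assumes B: "is_subring B" and C: "is_subring C" "C \<subseteq> B"
  shows "is_subring (fractions B C)"
  unfolding is_subring_def
proof (intro conjI ballI)
  show "0 \<in> fractions B C" "1 \<in> fractions B C"
    using to_fract_fractions[OF C(1), of 0 B] to_fract_fractions[OF C(1), of 1 B] B by (simp_all add: is_subring_def)
  fix x y assume "x \<in> fractions B C" "y \<in> fractions B C"
  then obtain p q r s where x: "x = to_fract p / to_fract q" "p \<in> B" "q \<in> C" "q \<noteq> 0"
    and y: "y = to_fract r / to_fract s" "r \<in> B" "s \<in> C" "s \<noteq> 0" unfolding fractions_def by blast
  have m: "p * s \<in> B" "r * q \<in> B" "p * r \<in> B" "q * s \<in> C"
    using x y B C unfolding is_subring_def by auto
  then have "p * s + r * q \<in> B" "p * s - r * q \<in> B" using B unfolding is_subring_def by auto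
  moreover have "q * s \<noteq> 0" using x y by simp
  ultimately show "x + y \<in> fractions B C" "x - y \<in> fractions B C" "x * y \<in> fractions B C"
    unfolding x(1) y(1)
    using fractionsI[OF _ m(4), of "p * s + r * q" B] fractionsI[OF _ m(4), of "p * s - r * q" B]
      fractionsI[OF m(3) m(4)] x(4) y(4)
    by (simp_all add: add_frac_eq diff_frac_eq)
qed

lemma subfield_fractions:
  assumes "is_subring R"
  shows "is_subfield (fractions R R)"
proof -
  have "x / y \<in> fractions R R" if xy: "x \<in> fractions R R" "y \<in> fractions R R" for x y
  proof -
    obtain p q r s where x: "x = to_fract p / to_fract q" "p \<in> R" "q \<in> R" "q \<noteq> 0"
      and y: "y = to_fract r / to_fract s" "r \<in> R" "s \<in> R" "s \<noteq> 0"
      using xy unfolding fractions_def by blast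
    show ?thesis
    proof (cases "r = 0")
      case True
      then show ?thesis using subring_fractions[OF assms assms] y by (auto simp: is_subring_def)
    next
      case False
      have "p * s \<in> R" "q * r \<in> R" using x y assms unfolding is_subring_def by auto
      then show ?thesis using x y False by (auto intro!: fractionsI[of "p * s" R "q * r"])
    qed
  qed
  then show ?thesis
    using subring_fractions[OF assms assms] unfolding is_subfield_def is_subring_def by blast
qed

lemma fractions_mono: "B \<subseteq> B' \<Longrightarrow> C \<subseteq> C' \<Longrightarrow> fractions B C \<subseteq> fractions B' C'"
  unfolding fractions_def by blast

lemma fractions_common_denominator:
  assumes "finite X" "X \<subseteq> fractions B C" "is_subring B" "is_subring C" "C \<subseteq> B"
  shows "\<exists>c\<in>C. c \<noteq> 0 \<and> (\<forall>x\<in>X. \<exists>s\<in>B. to_fract c * x = to_fract s)"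
  using assms(1,2)
proof (induction X)
  case empty
  then show ?case using assms(4) by (auto simp: is_subring_def intro!: bexI[of _ 1])
next
  case (insert x X)
  then obtain c where c: "c \<in> C" "c \<noteq> 0" "\<And>x. x \<in> X \<Longrightarrow> \<exists>s\<in>B. to_fract c * x = to_fract s" by auto
  obtain p q where x: "x = to_fract p / to_fract q" "p \<in> B" "q \<in> C" "q \<noteq> 0"
    using insert.prems unfolding fractions_def by blast
  have "\<exists>s\<in>B. to_fract (c * q) * y = to_fract s" if "y \<in> insert x X" for y
  proof (cases "y = x")
    case True
    have "c * p \<in> B" using c x assms unfolding is_subring_def by auto
    then show ?thesis using True x by (auto intro!: bexI[of _ "c * p"])
  next
    case False
    with that c(3)[of y] obtain s where s: "s \<in> B" "to_fract c * y = to_fract s" by auto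
    have "to_fract (c * q) * y = to_fract q * (to_fract c * y)" by (simp add: mult_ac)
    also have "\<dots> = to_fract (q * s)" by (simp add: s(2))
    finally have "to_fract (c * q) * y = to_fract (q * s)" .
    moreover have "q * s \<in> B" using s x assms unfolding is_subring_def by auto
    ultimately show ?thesis by blast
  qed
  moreover have "c * q \<in> C" "c * q \<noteq> 0" using c x assms(4) unfolding is_subring_def by auto
  ultimately show ?case by blast
qed

lemma subring_fps_of_poly: "is_subring (range (fps_of_poly :: 'a::field poly poly \<Rightarrow> _))"
  unfolding is_subring_def
proof (intro conjI ballI)
  have "0 = fps_of_poly (0 :: 'a poly poly)" "1 = fps_of_poly (1 :: 'a poly poly)" by simp_all
  then show "0 \<in> range (fps_of_poly :: 'a poly poly \<Rightarrow> _)" "1 \<in> range (fps_of_poly :: 'a poly poly \<Rightarrow> _)"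
    by blast+
  fix x y assume "x \<in> range (fps_of_poly :: 'a poly poly \<Rightarrow> _)" "y \<in> range (fps_of_poly :: 'a poly poly \<Rightarrow> _)"
  then obtain p q where "x = fps_of_poly p" "y = fps_of_poly q" by blast
  then show "x + y \<in> range fps_of_poly" "x - y \<in> range fps_of_poly" "x * y \<in> range fps_of_poly"
    by (auto simp flip: fps_of_poly_add fps_of_poly_diff fps_of_poly_mult)
qed

lemma rat_funs_eq: "rat_funs = fractions (range fps_of_poly) (range fps_of_poly)"
proof -
  have "fps_of_poly q = 0 \<longleftrightarrow> q = 0" for q :: "'a poly poly"
    using fps_of_poly_eq_iff[of q 0] by simp
  then show ?thesis unfolding rat_funs_def fractions_def image_def by (auto; metis)
qed

lemma subfield_rat_funs: "is_subfield rat_funs"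
  unfolding rat_funs_eq by (rule subfield_fractions[OF subring_fps_of_poly])

lemma fps_X_fps_of_poly: "fps_X \<in> range fps_of_poly"
  by (rule range_eqI[of _ _ "[:0, 1:]"]) simp

lemma fps_const_fps_of_poly: "fps_const p \<in> range fps_of_poly"
  by (metis fps_of_poly_const rangeI)

lemma zseries_fps_u_indep:
  assumes "\<And>l. z l \<in> zseries" "(\<Sum>l\<le>B. z l * fps_u ^ l) = 0" "l \<le> B"
  shows "z l = 0"
proof (rule fps_ext)
  fix m
  define c where "c l = coeff (z l $ m) 0" for l
  have c: "z l $ m = [:c l:]" for l
  proof -
    have "degree (z l $ m) = 0" using assms(1)[of l] by (simp add: zseries_def)
    then obtain d where "z l $ m = [:d:]" by (rule degree_eq_zeroE)
    then show ?thesis by (simp add: c_def)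
  qed
  have "0 = (\<Sum>l\<le>B. z l * fps_u ^ l) $ m" using assms(2) by simp
  also have "\<dots> = (\<Sum>l\<le>B. monom (c l) l)"
    by (simp add: fps_sum_nth fps_u_def fps_const_power c monom_altdef)
  finally have "coeff (\<Sum>l\<le>B. monom (c l) l) l = 0" by simp
  then have "c l = 0" using assms(3) by (simp add: coeff_sum)
  then show "z l $ m = 0 $ m" by (simp add: c)
qed

definition zfield :: "'a::field poly fps fract set" where "zfield = fractions zseries zseries"

lemma subfield_zfield: "is_subfield zfield"
  unfolding zfield_def by (rule subfield_fractions[OF subring_zseries])

lemma to_fract_power: "to_fract (x ^ m) = to_fract x ^ m"
  by (induction m) simp_all

text \<open>Clearing denominators turns an algebraic relation into a linear relation between powers
  of u over K[[t]], where these powers are independent.\<close>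

lemma fps_u_transcendental: "\<not> algebraic_over zfield (to_fract fps_u)"
proof
  assume "algebraic_over zfield (to_fract (fps_u :: 'a poly fps))"
  then obtain P where P: "P \<noteq> 0" "\<And>j. coeff P j \<in> zfield" "poly P (to_fract (fps_u :: 'a poly fps)) = 0"
    unfolding algebraic_over_def by blast
  have "\<exists>c\<in>zseries. c \<noteq> 0 \<and> (\<forall>x\<in>coeff P ` {..degree P}. \<exists>s\<in>zseries. to_fract c * x = to_fract s)"
    by (rule fractions_common_denominator) (use P in \<open>auto simp: zfield_def subring_zseries\<close>)
  then obtain c where c: "c \<noteq> 0" "\<forall>j\<in>{..degree P}. \<exists>s\<in>zseries. to_fract c * coeff P j = to_fract s"
    by auto
  then have "\<forall>j. \<exists>s\<in>zseries. j \<le> degree P \<longrightarrow> to_fract c * coeff P j = to_fract s"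
    using subring_zseries unfolding is_subring_def by blast
  then obtain z where z: "\<And>j. z j \<in> zseries" "\<And>j. j \<le> degree P \<Longrightarrow> to_fract c * coeff P j = to_fract (z j)"
    by metis
  have "0 = to_fract c * poly P (to_fract fps_u)" using P by simp
  also have "\<dots> = (\<Sum>j\<le>degree P. to_fract (z j) * to_fract fps_u ^ j)"
    by (simp add: poly_altdef sum_distrib_left z(2)[symmetric] mult.assoc)
  also have "\<dots> = to_fract (\<Sum>j\<le>degree P. z j * fps_u ^ j)"
    by (simp add: to_fract_sum to_fract_power)
  finally have "(\<Sum>j\<le>degree P. z j * fps_u ^ j) = 0" by (metis to_fract_eq_0_iff)
  from zseries_fps_u_indep[OF z(1) this, of "degree P"] have "z (degree P) = 0" by simp
  with z(2)[of "degree P"] c(1) P(1) show False by simp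
qed

section \<open>Derivations that vanish on constants, t and u\<close>

definition good_derivation :: "('a::field poly fps fract \<Rightarrow> 'a poly fps fract) \<Rightarrow> bool" where
  "good_derivation D \<longleftrightarrow> derivation_on UNIV D \<and> D (to_fract fps_u) = 0 \<and> D (to_fract fps_X) = 0 \<and>
    (\<forall>c. D (to_fract (fps_scalar c)) = 0)"

lemma subfield_UNIV: "is_subfield UNIV"
  by (simp add: is_subfield_def)

lemma derivation_on_zero: "derivation_on E (\<lambda>_. 0)"
  by (simp add: derivation_on_def)

lemma good_derivation_if_rat_funs:
  assumes "derivation_on UNIV D" "\<And>y. y \<in> rat_funs \<Longrightarrow> D y = 0"
  shows "good_derivation D"
proof -
  have "to_fract p \<in> rat_funs" if "p \<in> range fps_of_poly" for p :: "'a poly fps"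
    unfolding rat_funs_eq by (rule to_fract_fractions[OF subring_fps_of_poly that])
  then show ?thesis
    using assms fps_X_fps_of_poly fps_const_fps_of_poly
    unfolding good_derivation_def fps_u_def fps_scalar_def by blast
qed

text \<open>On \<open>\<bbbK>[[t]]\<close> such a derivation is not \<open>t\<close>-adically continuous: the denominators of its values
  are unbounded. This is why it can only be applied to elements of \<open>\<bbbK>[[t]][u]\<close> later on.\<close>

lemma zseries_derivation_exists:
  fixes y :: "'a::field_char_0 poly fps"
  assumes y: "y \<in> zseries" and tr: "\<not> algebraic_over rat_funs (to_fract y)"
  obtains D where "good_derivation D" "D ` zfield \<subseteq> zfield" "D (to_fract y) = 1"
proof -
  \<comment> \<open>\<open>R\<close> is K[t], so \<open>fractions R R\<close> is K(t), on which the
    zero derivation is the starting point.\<close>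
  define R where "R = (zseries \<inter> range fps_of_poly :: 'a poly fps set)"
  have R: "is_subring R"
    using subring_zseries[where 'a = 'a] subring_fps_of_poly[where 'a = 'a]
    unfolding R_def is_subring_def by blast
  have sub: "fractions R R \<subseteq> zfield" "fractions R R \<subseteq> rat_funs"
    unfolding zfield_def rat_funs_eq R_def by (intro fractions_mono; blast)+
  have "\<not> algebraic_over (fractions R R) (to_fract y)"
    using tr sub(2) unfolding algebraic_over_def by blast
  moreover have y': "to_fract y \<in> zfield" and "(1 :: 'a poly fps fract) \<in> zfield"
      "(\<lambda>_. 0 :: 'a poly fps fract) ` fractions R R \<subseteq> zfield"
    using to_fract_fractions[OF subring_zseries y] subfield_zfield[where 'a = 'a]
    by (auto simp: zfield_def is_subfield_def)
  ultimately obtain D1 where D1: "derivation_on zfield D1" "D1 ` zfield \<subseteq> zfield"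
      "\<And>z. z \<in> fractions R R \<Longrightarrow> D1 z = 0" "D1 (to_fract y) = 1"
    using derivation_extend[of zfield "fractions R R" "\<lambda>_. 0" "to_fract y" 1]
      subfield_zfield subfield_fractions[OF R] sub(1) derivation_on_zero by blast
  \<comment> \<open>The extension from K((t)) to the whole fraction field may send u to 0, since u
    is transcendental over K((t)).\<close>
  obtain D where D: "derivation_on UNIV D" "\<And>z. z \<in> zfield \<Longrightarrow> D z = D1 z" "D (to_fract fps_u) = 0"
    by (rule derivation_extend[OF subfield_UNIV subfield_zfield subset_UNIV D1(1) subset_UNIV
          UNIV_I UNIV_I fps_u_transcendental, of 0]) (rule that)
  have "D (to_fract p) = 0" if "p \<in> R" for p
    using D(2) D1(3) sub(1) to_fract_fractions[OF R that] by (metis subsetD)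
  moreover have "fps_X \<in> R" "fps_scalar c \<in> R" for c
    unfolding R_def using fps_X_zseries fps_scalar_zseries fps_X_fps_of_poly fps_const_fps_of_poly
    by (auto simp: fps_scalar_def)
  ultimately have "good_derivation D" using D unfolding good_derivation_def by blast
  moreover have "D ` zfield \<subseteq> zfield" using D(2) D1(2) by auto
  moreover have "D (to_fract y) = 1" using D(2) D1(4) y' by simp
  ultimately show ?thesis using that by blast
qed

lemma derivation_onD:
  assumes "derivation_on UNIV D"
  shows "D (x + y) = D x + D y" "D (x * y) = x * D y + y * D x" "D 0 = 0" "D 1 = 0" "D (x - y) = D x - D y"
proof -
  show p: "D (x + y) = D x + D y" "D (x * y) = x * D y + y * D x" for x y
    using assms unfolding derivation_on_def by blast+
  show "D 0 = 0" "D 1 = 0" using derivation_on_zero_one[OF subfield_UNIV assms] .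
  show "D (x - y) = D x - D y" using p(1)[of "x - y" y] by simp
qed

lemma derivation_sum: "derivation_on UNIV D \<Longrightarrow> D (sum g I) = (\<Sum>i\<in>I. D (g i))"
  by (induction I rule: infinite_finite_induct) (auto simp: derivation_onD)

lemma derivation_power_zero: "derivation_on UNIV D \<Longrightarrow> D x = 0 \<Longrightarrow> D (x ^ m) = 0"
  by (induction m) (auto simp: derivation_onD)

text \<open>\<open>A\<close> is a finite sum of terms \<open>z l * fps_u ^ l\<close>, and
  \<open>D\<close> only acts on the \<open>z l\<close>, with values in K((t)). Finiteness gives a
  common denominator in K[[t]].\<close>

lemma derivation_useries:
  assumes D: "good_derivation D" "D ` zfield \<subseteq> zfield" and A: "A \<in> useries"
  shows "D (to_fract A) \<in> fractions UNIV zseries"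
proof -
  obtain B z where z: "\<And>l. z l \<in> zseries" "A = (\<Sum>l\<le>B. z l * fps_u ^ l)"
    using useries_expand[OF A] by blast
  have der: "derivation_on UNIV D" and u: "D (to_fract fps_u) = 0"
    using D(1) unfolding good_derivation_def by blast+
  have sr: "is_subring (fractions (UNIV :: 'a poly fps set) zseries)"
    by (rule subring_fractions) (use subring_zseries in \<open>auto simp: is_subring_def\<close>)
  have "D (to_fract A) = (\<Sum>l\<le>B. to_fract fps_u ^ l * D (to_fract (z l)))"
    by (simp add: z(2) to_fract_sum to_fract_power derivation_sum[OF der] derivation_onD[OF der]
        derivation_power_zero[OF der u])
  moreover have "to_fract (fps_u ^ l) * D (to_fract (z l)) \<in> fractions UNIV zseries" for l
  proof -
    have "D (to_fract (z l)) \<in> zfield"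
      using D(2) to_fract_fractions[OF subring_zseries z(1)] unfolding zfield_def by blast
    then have "D (to_fract (z l)) \<in> fractions UNIV zseries"
      using fractions_mono[of zseries UNIV zseries zseries] unfolding zfield_def by blast
    then show ?thesis
      using sr to_fract_fractions[OF subring_zseries UNIV_I] unfolding is_subring_def by blast
  qed
  moreover have "sum g I \<in> fractions UNIV zseries" if "\<And>i. g i \<in> fractions (UNIV :: 'a poly fps set) zseries"
    for g :: "nat \<Rightarrow> _" and I
    using that sr by (induction I rule: infinite_finite_induct) (auto simp: is_subring_def)
  ultimately show ?thesis by (simp add: to_fract_power)
qed

text \<open>\<open>B\<close> is the adjugate and \<open>d\<close> the determinant. Taking the
  constant coefficient is a ring homomorphism, so it commutes with the determinant and meets a
  scalar matrix.\<close>

lemma adjugate_exists: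
  fixes A :: "nat \<Rightarrow> nat \<Rightarrow> 'b::comm_ring_1 fps"
  assumes "\<And>i j. i < n \<Longrightarrow> j < n \<Longrightarrow> A i j $ 0 = (if i = j then p else 0)"
  obtains d B where "d $ 0 = p ^ n"
    "\<And>i j. i < n \<Longrightarrow> j < n \<Longrightarrow> (\<Sum>l<n. A i l * B l j) = (if i = j then d else 0)"
    "\<And>i j. i < n \<Longrightarrow> j < n \<Longrightarrow> (\<Sum>l<n. B i l * A l j) = (if i = j then d else 0)"
proof -
  define M where "M = mat n n (\<lambda>(i, j). A i j)"
  define B where "B i j = adj_mat M $$ (i, j)" for i j
  have M: "M \<in> carrier_mat n n" by (simp add: M_def)
  note adj = adj_mat[OF M]
  have dims [simp]: "dim_row (adj_mat M) = n" "dim_col (adj_mat M) = n" "dim_row M = n" "dim_col M = n"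
    using adj(1) M by auto
  have entry: "M $$ (i, j) = A i j" if "i < n" "j < n" for i j
    using that by (simp add: M_def)
  have 1: "(\<Sum>l<n. A i l * B l j) = (if i = j then det M else 0)" if "i < n" "j < n" for i j
  proof -
    have "(M * adj_mat M) $$ (i, j) = (\<Sum>l<n. A i l * B l j)"
      using that by (simp add: scalar_prod_def B_def entry atLeast0LessThan)
    then show ?thesis using adj(2) that by (cases "i = j") auto
  qed
  have 2: "(\<Sum>l<n. B i l * A l j) = (if i = j then det M else 0)" if "i < n" "j < n" for i j
  proof -
    have "(adj_mat M * M) $$ (i, j) = (\<Sum>l<n. B i l * A l j)"
      using that by (simp add: scalar_prod_def B_def entry atLeast0LessThan)
    then show ?thesis using adj(3) that by (cases "i = j") auto
  qed
  interpret h: comm_ring_hom "\<lambda>a :: 'b fps. a $ 0"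
    by unfold_locales simp_all
  have "map_mat (\<lambda>a. a $ 0) M = p \<cdot>\<^sub>m 1\<^sub>m n"
    using assms by (intro eq_matI) (auto simp: M_def)
  then have "det M $ 0 = p ^ n"
    using h.hom_det[of M] by simp
  then show ?thesis using that[of "det M" B] 1 2 by blast
qed

lemma fps_X_power_dvd_iff: "fps_X ^ m dvd (A :: 'b::comm_ring_1 fps) \<longleftrightarrow> (\<forall>j<m. A $ j = 0)"
proof
  assume "\<forall>j<m. A $ j = 0"
  then have "fps_cutoff m A = 0" by (intro fps_ext) simp
  then have "A = fps_shift m A * fps_X ^ m" using fps_shift_cutoff[of m A] by simp
  then show "fps_X ^ m dvd A" by (metis dvd_triv_right)
qed (auto elim!: dvdE simp: fps_X_power_mult_nth)

lemma left_inverse_apply: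
  fixes A B :: "nat \<Rightarrow> nat \<Rightarrow> 'b::comm_ring_1"
  assumes "\<And>j. j < n \<Longrightarrow> (\<Sum>l<n. B i l * A l j) = (if i = j then d else 0)" "i < n"
  shows "(\<Sum>l<n. B i l * (\<Sum>j<n. A l j * x j)) = d * x i"
proof -
  have "(\<Sum>l<n. B i l * (\<Sum>j<n. A l j * x j)) = (\<Sum>l<n. \<Sum>j<n. B i l * A l j * x j)"
    by (simp add: sum_distrib_left mult.assoc)
  also have "\<dots> = (\<Sum>j<n. (\<Sum>l<n. B i l * A l j) * x j)"
    by (subst sum.swap) (simp add: sum_distrib_right)
  also have "\<dots> = (\<Sum>j<n. if j = i then d * x j else 0)"
    by (intro sum.cong) (auto simp: assms(1))
  finally show ?thesis using assms(2) by simp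
qed

lemma good_derivation_const:
  assumes "good_derivation D"
  shows "D (to_fract (fps_const p)) = 0"
proof (induction p)
  case 0
  then show ?case using assms derivation_onD(3) by (auto simp: good_derivation_def)
next
  case (pCons c p)
  have "fps_const (pCons c p) = fps_scalar c + fps_u * fps_const p"
    by (simp add: fps_scalar_def fps_u_def)
  then show ?case using assms pCons.IH by (simp add: good_derivation_def derivation_onD)
qed

lemma useries_peval: "(\<And>v. v \<in> pvars e \<Longrightarrow> x v \<in> useries) \<Longrightarrow> peval x e \<in> useries"
proof (induction e)
  case (Cst c)
  then show ?case by (simp add: fps_scalar_zseries zseries_useries)
qed (use subring_useries in \<open>auto simp: is_subring_def\<close>)

lemma derivation_u_minus: "D (to_fract (u_minus c)) = 0" if "good_derivation D"
  using that by (simp add: u_minus_def good_derivation_def derivation_onD)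

section \<open>Systems with one catalytic variable\<close>

locale catalytic =
  fixes a :: "'a::field_char_0" and n k :: nat and f :: "nat \<Rightarrow> 'a poly" and e :: "nat \<Rightarrow> 'a pexp"
  assumes vars: "i < n \<Longrightarrow> pvars (e i) \<subseteq> VarY ` {..<n * Suc k} \<union> {VarT, VarU}"
begin

text \<open>The index \<open>p = j * Suc k + l\<close> with \<open>l \<le> k\<close> encodes the
  \<open>l\<close>-th divided difference of component \<open>j\<close>, both counted from 0.\<close>

definition asg :: "(nat \<Rightarrow> 'a poly fps) \<Rightarrow> var \<Rightarrow> 'a poly fps" where
  "asg F v = (case v of VarY p \<Rightarrow> (Delta a ^^ (p mod Suc k)) (F (p div Suc k))
    | VarT \<Rightarrow> fps_X | VarU \<Rightarrow> fps_u)"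

definition rhs :: "(nat \<Rightarrow> 'a poly fps) \<Rightarrow> nat \<Rightarrow> 'a poly fps" where
  "rhs F i = fps_const (f i) + fps_X * peval (asg F) (e i)"

definition sol :: "(nat \<Rightarrow> 'a poly fps) \<Rightarrow> bool" where
  "sol F \<longleftrightarrow> (\<forall>i<n. F i = rhs F i)"

definition grad :: "(nat \<Rightarrow> 'a poly fps) \<Rightarrow> nat \<Rightarrow> nat \<Rightarrow> 'a poly fps" where
  "grad F i p = peval (asg F) (pdiff (VarY p) (e i))"

text \<open>The Jacobian matrix of the system multiplied by \<open>(u - a)^k\<close>. The
  \<open>l\<close>-th divided difference of \<open>F j\<close> is read as \<open>F j\<close> minus
  its Taylor terms, divided by \<open>(u - a)^l\<close>; with the Taylor coefficients held fixed,
  the factor \<open>(u - a)^(k - l)\<close> remains.\<close>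

definition jac :: "(nat \<Rightarrow> 'a poly fps) \<Rightarrow> nat \<Rightarrow> nat \<Rightarrow> 'a poly fps" where
  "jac F i j = (if i = j then u_minus a ^ k else 0) -
    fps_X * (\<Sum>p | p < n * Suc k \<and> p div Suc k = j. grad F i p * u_minus a ^ (k - p mod Suc k))"

section \<open>Existence and uniqueness by t-adic contraction\<close>

lemma index_div_mod: "p < n * Suc k \<Longrightarrow> p div Suc k < n" "p mod Suc k \<le> k"
  by (simp_all add: less_mult_imp_div_less less_Suc_eq_le[symmetric] del: mult_Suc_right)

text \<open>Divided differences and polynomials preserve congruence modulo \<open>fps_X ^ m\<close>,
  and the factor t in front gains one power.\<close>

lemma rhs_cong:
  assumes "\<And>j. j < n \<Longrightarrow> fps_X ^ m dvd F j - G j" "i < n"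
  shows "fps_X ^ Suc m dvd rhs F i - rhs G i"
proof -
  have "fps_X ^ m dvd asg F v - asg G v" if "v \<in> pvars (e i)" for v
  proof (cases v)
    case (VarY p)
    with that vars[OF assms(2)] have "p < n * Suc k" by auto
    then have "fps_X ^ m dvd F (p div Suc k) - G (p div Suc k)" using assms(1) index_div_mod(1) by blast
    then show ?thesis using VarY by (simp add: asg_def flip: Delta_pow_diff) (rule fps_X_dvd_Delta_pow)
  qed (simp_all add: asg_def)
  then have "fps_X ^ m dvd peval (asg F) (e i) - peval (asg G) (e i)" by (rule dvd_peval_diff)
  then have "fps_X * fps_X ^ m dvd fps_X * (peval (asg F) (e i) - peval (asg G) (e i))"
    by (intro mult_dvd_mono) auto
  then show ?thesis by (simp add: rhs_def right_diff_distrib)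
qed

lemma sol_unique:
  assumes "sol F" "sol G" "i < n"
  shows "F i = G i"
proof -
  have "\<forall>i<n. fps_X ^ m dvd F i - G i" for m
  proof (induction m)
    case (Suc m)
    then show ?case using rhs_cong[of m F G] assms unfolding sol_def by metis
  qed simp
  then have "F i - G i = 0" using assms(3) by (intro fps_eq_0_if_X_dvd) blast
  then show ?thesis by simp
qed

lemma sol_exists: "\<exists>F. sol F"
proof -
  define A where "A m = (rhs ^^ m) (\<lambda>_. 0)" for m
  have A_Suc: "A (Suc m) = rhs (A m)" for m by (simp add: A_def)
  have step: "\<forall>i<n. fps_X ^ m dvd A (Suc m) i - A m i" for m
  proof (induction m)
    case (Suc m)
    then show ?case using rhs_cong[of m "A (Suc m)" "A m"] A_Suc by metis
  qed simp
  have mono: "fps_X ^ m dvd A (m + d) i - A m i" if "i < n" for m d i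
  proof (induction d)
    case (Suc d)
    have "fps_X ^ m dvd A (Suc (m + d)) i - A (m + d) i"
      using step[of "m + d"] that by (meson dvd_trans le_add1 le_imp_power_dvd)
    from dvd_add[OF this Suc] show ?case by simp
  qed simp
  \<comment> \<open>Iterates from number \<open>Suc j\<close> on agree modulo
    \<open>fps_X ^ Suc j\<close>, so the coefficient at \<open>j\<close> is final there.\<close>
  define F where "F i = Abs_fps (\<lambda>j. A (Suc j) i $ j)" for i
  have F: "fps_X ^ m dvd F i - A m i" if "i < n" for m i
    unfolding fps_X_power_dvd_iff
  proof (intro allI impI)
    fix j assume "j < m"
    then obtain d where m: "m = Suc j + d" by (metis less_iff_Suc_add add_Suc)
    have "(A m i - A (Suc j) i) $ j = 0"
      using mono[OF that, of "Suc j" d] unfolding m fps_X_power_dvd_iff by blast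
    then show "(F i - A m i) $ j = 0" by (simp add: F_def)
  qed
  have "F i = rhs F i" if "i < n" for i
  proof -
    have "fps_X ^ m dvd F i - rhs F i" for m
    proof -
      have "fps_X ^ Suc m dvd (F i - A (Suc m) i) - (rhs F i - rhs (A m) i)"
        by (intro dvd_diff F rhs_cong that)
      then have "fps_X ^ Suc m dvd F i - rhs F i" by (simp add: A_Suc)
      then show ?thesis by (rule power_le_dvd) simp
    qed
    then have "F i - rhs F i = 0" by (rule fps_eq_0_if_X_dvd)
    then show ?thesis by simp
  qed
  then show ?thesis unfolding sol_def by blast
qed

text \<open>The indices \<open>p\<close> are grouped by their component \<open>p div Suc k\<close>.
  The map \<open>\<phi>\<close> is the identity in one use and \<open>to_fract\<close> in the
  other.\<close>

lemma jac_apply: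
  fixes \<phi> :: "'a poly fps \<Rightarrow> 'c::comm_ring_1"
  assumes hom: "\<And>x y. \<phi> (x - y) = \<phi> x - \<phi> y" "\<And>x y. \<phi> (x * y) = \<phi> x * \<phi> y"
    "\<And>g (I :: nat set). \<phi> (sum g I) = (\<Sum>i\<in>I. \<phi> (g i))" "\<phi> 0 = 0"
    and "i < n"
  shows "(\<Sum>j<n. \<phi> (jac F i j) * x j) = \<phi> (u_minus a ^ k) * x i -
     \<phi> fps_X * (\<Sum>p<n * Suc k. \<phi> (grad F i p * u_minus a ^ (k - p mod Suc k)) * x (p div Suc k))"
proof -
  let ?g = "\<lambda>p. \<phi> (grad F i p * u_minus a ^ (k - p mod Suc k))"
  have 1: "\<phi> (if i = j then u_minus a ^ k else 0) * x j = (if j = i then \<phi> (u_minus a ^ k) * x j else 0)" for j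
    by (simp add: hom(4))
  have "(\<Sum>j<n. \<Sum>p | p \<in> {..<n * Suc k} \<and> p div Suc k = j. ?g p * x (p div Suc k)) =
      (\<Sum>p<n * Suc k. ?g p * x (p div Suc k))"
    by (rule sum.group) (use index_div_mod(1) in auto)
  then have 2: "(\<Sum>j<n. (\<Sum>p | p < n * Suc k \<and> p div Suc k = j. ?g p) * x j) =
      (\<Sum>p<n * Suc k. ?g p * x (p div Suc k))"
    by (simp add: sum_distrib_right)
  have "(\<Sum>j<n. \<phi> (jac F i j) * x j) = (\<Sum>j<n. \<phi> (if i = j then u_minus a ^ k else 0) * x j) -
      \<phi> fps_X * (\<Sum>j<n. (\<Sum>p | p < n * Suc k \<and> p div Suc k = j. ?g p) * x j)"
  proof -
    have "\<phi> (jac F i j) * x j = \<phi> (if i = j then u_minus a ^ k else 0) * x j -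
        \<phi> fps_X * ((\<Sum>p | p < n * Suc k \<and> p div Suc k = j. ?g p) * x j)" for j
      by (simp only: jac_def hom left_diff_distrib mult.assoc)
    then show ?thesis by (simp only: sum_subtractf sum_distrib_left[symmetric])
  qed
  also have "(\<Sum>j<n. \<phi> (if i = j then u_minus a ^ k else 0) * x j) = \<phi> (u_minus a ^ k) * x i"
    using \<open>i < n\<close> by (simp add: 1)
  finally show ?thesis unfolding 2 .
qed

text \<open>Modulo t the matrix is \<open>(u - a)^k\<close> times the identity.\<close>

lemma jac_adjugate:
  obtains d B where "d $ 0 = [:-a, 1:] ^ (k * n)"
    "\<And>i j. i < n \<Longrightarrow> j < n \<Longrightarrow> (\<Sum>l<n. jac F i l * B l j) = (if i = j then d else 0)"
    "\<And>i j. i < n \<Longrightarrow> j < n \<Longrightarrow> (\<Sum>l<n. B i l * jac F l j) = (if i = j then d else 0)"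
proof -
  have *: "jac F i j $ 0 = (if i = j then [:-a, 1:] ^ k else 0)" for i j
    by (simp add: jac_def u_minus_eq fps_const_power)
  obtain d B where "d $ 0 = ([:-a, 1:] ^ k) ^ n"
    "\<And>i j. i < n \<Longrightarrow> j < n \<Longrightarrow> (\<Sum>l<n. jac F i l * B l j) = (if i = j then d else 0)"
    "\<And>i j. i < n \<Longrightarrow> j < n \<Longrightarrow> (\<Sum>l<n. B i l * jac F l j) = (if i = j then d else 0)"
    by (rule adjugate_exists[of n, OF *]) (rule that)
  then show ?thesis by (intro that[of d B]) (simp_all add: power_mult)
qed

lemma derivation_peval_asg:
  assumes D: "good_derivation D" and i: "i < n"
  shows "D (to_fract (peval (asg F) (e i))) = (\<Sum>p<n * Suc k. to_fract (grad F i p) *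
    D (to_fract ((Delta a ^^ (p mod Suc k)) (F (p div Suc k)))))"
proof -
  let ?V = "VarY ` {..<n * Suc k} \<union> {VarT, VarU}"
  let ?g = "\<lambda>v. to_fract (peval (asg F) (pdiff v (e i))) * D (to_fract (asg F v))"
  have D': "derivation_on UNIV D" "\<And>c. D (to_fract (fps_scalar c)) = 0"
    and tu: "D (to_fract fps_X) = 0" "D (to_fract fps_u) = 0"
    using D unfolding good_derivation_def by blast+
  have "D (to_fract (peval (asg F) (e i))) = sum ?g ?V"
    by (rule derivation_peval[OF D' _ vars[OF i]]) simp
  also have "\<dots> = sum ?g (VarY ` {..<n * Suc k})"
    by (rule sum.mono_neutral_right) (auto simp: asg_def tu)
  also have "\<dots> = (\<Sum>p<n * Suc k. ?g (VarY p))"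
    by (subst sum.reindex) (auto simp: inj_on_def)
  finally show ?thesis by (simp add: grad_def asg_def)
qed

text \<open>When \<open>D\<close> kills the Taylor coefficients below \<open>k\<close>, Taylor's
  formula turns \<open>(u - a)^l\<close> times the derivative of the \<open>l\<close>-th divided
  difference into \<open>D (F j)\<close>. The differentiated system, times \<open>(u - a)^k\<close>,
  then says that the Jacobian matrix kills the vector of the \<open>D (F j)\<close>, and its
  determinant is nonzero.\<close>

lemma sol_derivation:
  assumes F: "sol F" and D: "good_derivation D"
    and y: "\<And>j m. j < n \<Longrightarrow> m < k \<Longrightarrow> D (to_fract (eval_u a ((Delta a ^^ m) (F j)))) = 0"
    and i: "i < n"
  shows "D (to_fract (F i)) = 0"
proof -
  have der: "derivation_on UNIV D" and X: "D (to_fract fps_X) = 0"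
    using D unfolding good_derivation_def by blast+
  note dD = derivation_onD[OF der]
  have v: "D (to_fract (u_minus a) ^ m) = 0" for m
    by (rule derivation_power_zero[OF der derivation_u_minus[OF D]])
  have Dl: "to_fract (u_minus a) ^ l * D (to_fract ((Delta a ^^ l) (F j))) = D (to_fract (F j))"
    if "j < n" "l \<le> k" for j l
  proof -
    have "D (to_fract (u_minus a ^ l * (Delta a ^^ l) (F j))) = D (to_fract (F j))"
      unfolding u_minus_pow_Delta_pow
      using that by (simp add: dD to_fract_sum to_fract_power derivation_sum[OF der] v y)
    then show ?thesis by (simp add: dD to_fract_power v)
  qed
  obtain d B where d: "d $ 0 = [:-a, 1:] ^ (k * n)"
    "\<And>i j. i < n \<Longrightarrow> j < n \<Longrightarrow> (\<Sum>l<n. jac F i l * B l j) = (if i = j then d else 0)"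
    "\<And>i j. i < n \<Longrightarrow> j < n \<Longrightarrow> (\<Sum>l<n. B i l * jac F l j) = (if i = j then d else 0)"
    by (rule jac_adjugate[of F]) (rule that)
  have "(\<Sum>j<n. to_fract (jac F l j) * D (to_fract (F j))) = 0" if l: "l < n" for l
  proof -
    have "D (to_fract (F l)) = D (to_fract (rhs F l))" using F l unfolding sol_def by metis
    also have "\<dots> = to_fract fps_X * (\<Sum>p<n * Suc k. to_fract (grad F l p) *
        D (to_fract ((Delta a ^^ (p mod Suc k)) (F (p div Suc k)))))"
      by (simp add: rhs_def dD X good_derivation_const[OF D] derivation_peval_asg[OF D l])
    finally have "to_fract (u_minus a ^ k) * D (to_fract (F l)) = to_fract fps_X * (\<Sum>p<n * Suc k.
        to_fract (u_minus a ^ k) * (to_fract (grad F l p) *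
        D (to_fract ((Delta a ^^ (p mod Suc k)) (F (p div Suc k))))))"
      by (simp add: sum_distrib_left mult.left_commute)
    also have "(\<Sum>p<n * Suc k. to_fract (u_minus a ^ k) * (to_fract (grad F l p) *
        D (to_fract ((Delta a ^^ (p mod Suc k)) (F (p div Suc k)))))) =
      (\<Sum>p<n * Suc k. to_fract (grad F l p * u_minus a ^ (k - p mod Suc k)) * D (to_fract (F (p div Suc k))))"
    proof (rule sum.cong)
      fix p assume "p \<in> {..<n * Suc k}"
      then have p: "p div Suc k < n" "p mod Suc k \<le> k" using index_div_mod by auto
      have "u_minus a ^ k = u_minus a ^ (k - p mod Suc k) * u_minus a ^ (p mod Suc k)"
        using p(2) by (simp flip: power_add)
      then show "to_fract (u_minus a ^ k) * (to_fract (grad F l p) *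
          D (to_fract ((Delta a ^^ (p mod Suc k)) (F (p div Suc k))))) =
        to_fract (grad F l p * u_minus a ^ (k - p mod Suc k)) * D (to_fract (F (p div Suc k)))"
        by (simp add: Dl[OF p, symmetric] to_fract_power mult_ac)
    qed simp
    finally show ?thesis by (subst jac_apply[OF _ _ _ _ l]) (simp_all add: to_fract_sum)
  qed
  then have "to_fract d * D (to_fract (F i)) = 0"
    using left_inverse_apply[of n "\<lambda>i j. to_fract (B i j)" i "\<lambda>i j. to_fract (jac F i j)" "to_fract d"
      "\<lambda>j. D (to_fract (F j))"] i d(3)
    by (simp flip: to_fract_mult to_fract_sum)
  moreover have "d \<noteq> 0" using d(1) by auto
  ultimately show ?thesis by simp
qed

end

section \<open>Derivations vanish on the Taylor coefficients of a solution\<close>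

lemma umonic_power2: "umonic N W \<Longrightarrow> umonic (2 * N) (W\<^sup>2)"
  using umonic_mult[of N W N W] by (simp add: power2_eq_square mult_2)

context catalytic
begin

text \<open>The modulus is a square so that, after a derivation is applied, the error terms
  \<open>W\<^sup>2 * h i\<close> are still multiples of \<open>W\<close>.\<close>

lemma polynomial_approximation:
  assumes F: "sol F" and W: "umonic N W"
  obtains r Q h where "\<And>j. r j \<in> useries" "\<And>j. r j = F j - u_minus a ^ k * (W\<^sup>2 * Q j)"
    "\<And>i. i < n \<Longrightarrow> r i - rhs r i = W\<^sup>2 * h i" "\<And>i. i < n \<Longrightarrow> h i \<in> useries"
proof -
  have W2: "umonic (2 * N) (W\<^sup>2)" using W by (rule umonic_power2)
  have "\<exists>q r. F j = u_minus a ^ k * W\<^sup>2 * q + r \<and> r \<in> useries" for j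
    using umonic_division[OF umonic_mult[OF umonic_u_minus_pow[of k a] W2], of "F j"] by metis
  then obtain Q r where r: "\<And>j. F j = u_minus a ^ k * W\<^sup>2 * Q j + r j" "\<And>j. r j \<in> useries"
    by metis
  have r': "r j = F j - u_minus a ^ k * (W\<^sup>2 * Q j)" for j
    using r(1)[of j] by (simp add: mult.assoc)
  have "\<exists>h. r i - rhs r i = W\<^sup>2 * h \<and> h \<in> useries" if i: "i < n" for i
  proof -
    \<comment> \<open>Divided differences up to order \<open>k\<close> use up only the factor
      \<open>(u - a)^k\<close> of \<open>F - r\<close>, so \<open>W\<^sup>2\<close>
      survives.\<close>
    have "W\<^sup>2 dvd asg r v - asg F v" if "v \<in> pvars (e i)" for v
    proof (cases v)
      case (VarY p)
      with that vars[OF i] have p: "p < n * Suc k" by auto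
      have "(Delta a ^^ (p mod Suc k)) (r (p div Suc k)) = (Delta a ^^ (p mod Suc k)) (F (p div Suc k)) -
          u_minus a ^ (k - p mod Suc k) * (W\<^sup>2 * Q (p div Suc k))"
        unfolding r' Delta_pow_diff by (simp only: Delta_pow_u_minus[OF index_div_mod(2)])
      then show ?thesis using VarY by (simp add: asg_def)
    qed (simp_all add: asg_def)
    then have "W\<^sup>2 dvd peval (asg r) (e i) - peval (asg F) (e i)" by (rule dvd_peval_diff)
    then have "W\<^sup>2 dvd fps_X * (peval (asg r) (e i) - peval (asg F) (e i))" by (rule dvd_mult)
    then have "W\<^sup>2 dvd rhs r i - rhs F i" by (simp add: rhs_def right_diff_distrib)
    moreover have "W\<^sup>2 dvd r i - F i" by (simp add: r')
    ultimately have "W\<^sup>2 dvd (r i - F i) - (rhs r i - rhs F i)" by (rule dvd_diff[rotated])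
    then have "W\<^sup>2 dvd r i - rhs r i" using F i unfolding sol_def by simp
    then obtain h where h: "r i - rhs r i = W\<^sup>2 * h" by (elim dvdE)
    have Dl: "(Delta a ^^ l) A \<in> useries" if "A \<in> useries" for l A
      using that by (induction l) (auto intro: Delta_useries)
    have "asg r v \<in> useries" for v
      by (cases v) (auto simp: asg_def r(2) Dl fps_X_zseries zseries_useries fps_u_def fps_const_useries)
    then have "peval (asg r) (e i) \<in> useries" by (rule useries_peval)
    then have "r i - rhs r i \<in> useries"
      using r(2)[of i] subring_useries fps_X_zseries zseries_useries fps_const_useries
      unfolding rhs_def is_subring_def by blast
    then have "h \<in> useries" using umonic_quotient[OF W2] h by simp
    with h show ?thesis by blast
  qed
  then obtain h where "\<And>i. i < n \<Longrightarrow> r i - rhs r i = W\<^sup>2 * h i" "\<And>i. i < n \<Longrightarrow> h i \<in> useries"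
    by metis
  then show ?thesis using that[OF r(2) r'] by blast
qed

text \<open>Every pass through the equation gains a factor t, so \<open>G i\<close> is divisible by
  all powers of t.\<close>

lemma linear_sol_zero:
  assumes "\<And>i. i < n \<Longrightarrow> G i = fps_X * (\<Sum>p<n * Suc k. c i p * (Delta a ^^ (p mod Suc k)) (G (p div Suc k)))"
    and "i < n"
  shows "G i = 0"
proof -
  have "\<forall>i<n. fps_X ^ m dvd G i" for m
  proof (induction m)
    case (Suc m)
    show ?case
    proof (intro allI impI)
      fix i assume i: "i < n"
      have "fps_X ^ m dvd (\<Sum>p<n * Suc k. c i p * (Delta a ^^ (p mod Suc k)) (G (p div Suc k)))"
        using Suc index_div_mod(1) by (intro dvd_sum dvd_mult fps_X_dvd_Delta_pow) auto
      then have "fps_X * fps_X ^ m dvd fps_X * (\<Sum>p<n * Suc k. c i p * (Delta a ^^ (p mod Suc k)) (G (p div Suc k)))"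
        by (rule mult_dvd_mono[OF dvd_refl])
      then show "fps_X ^ Suc m dvd G i" by (subst assms(1)[OF i]) simp
    qed
  qed simp
  with assms(2) show ?thesis by (intro fps_eq_0_if_X_dvd) blast
qed

text \<open>A multiple of \<open>(u - a)^k\<close>, found by inverting the Jacobian matrix up to its determinant \<open>d\<close>, absorbs
  the inhomogeneity; what remains solves a homogeneous linear system, hence vanishes.\<close>

lemma linear_sol_dvd:
  assumes adj: "\<And>i j. i < n \<Longrightarrow> j < n \<Longrightarrow> (\<Sum>l<n. jac F i l * B l j) = (if i = j then d else 0)"
    and G: "\<And>i. i < n \<Longrightarrow> G i = fps_X * (\<Sum>p<n * Suc k. grad F i p *
      (Delta a ^^ (p mod Suc k)) (G (p div Suc k))) + d * q * H i"
    and i: "i < n"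
  shows "u_minus a ^ k dvd G i"
proof -
  \<comment> \<open>\<open>C\<close> is the adjugate applied to \<open>q * H\<close>, so the
    Jacobian matrix maps it to \<open>d * q * H\<close>.\<close>
  define C where "C i = (\<Sum>l<n. B i l * (q * H l))" for i
  have JC: "u_minus a ^ k * C i - fps_X * (\<Sum>p<n * Suc k. grad F i p * u_minus a ^ (k - p mod Suc k) * C (p div Suc k)) =
      d * q * H i" if "i < n" for i
  proof -
    have "(\<Sum>j<n. jac F i j * C j) = d * (q * H i)"
      unfolding C_def by (rule left_inverse_apply) (use adj that in auto)
    then show ?thesis using jac_apply[of "\<lambda>x. x" i F C] that by (simp add: mult.assoc)
  qed
  define G' where "G' i = G i - u_minus a ^ k * C i" for i
  have "G' i = 0"
  proof (rule linear_sol_zero[OF _ i])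
    fix i assume i: "i < n"
    have "(\<Sum>p<n * Suc k. grad F i p * (Delta a ^^ (p mod Suc k)) (G' (p div Suc k))) =
      (\<Sum>p<n * Suc k. grad F i p * (Delta a ^^ (p mod Suc k)) (G (p div Suc k)) -
        grad F i p * u_minus a ^ (k - p mod Suc k) * C (p div Suc k))"
      using index_div_mod(2) by (intro sum.cong) (auto simp: G'_def Delta_pow_diff Delta_pow_u_minus algebra_simps)
    then have "fps_X * (\<Sum>p<n * Suc k. grad F i p * (Delta a ^^ (p mod Suc k)) (G' (p div Suc k))) =
      fps_X * (\<Sum>p<n * Suc k. grad F i p * (Delta a ^^ (p mod Suc k)) (G (p div Suc k))) -
      fps_X * (\<Sum>p<n * Suc k. grad F i p * u_minus a ^ (k - p mod Suc k) * C (p div Suc k))"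
      by (simp only: sum_subtractf right_diff_distrib)
    also have "\<dots> = (G i - d * q * H i) - (u_minus a ^ k * C i - d * q * H i)"
      using JC[OF i] by (subst G[OF i]) (simp add: algebra_simps)
    finally show "G' i = fps_X * (\<Sum>p<n * Suc k. grad F i p * (Delta a ^^ (p mod Suc k)) (G' (p div Suc k)))"
      by (simp add: G'_def)
  qed
  then show ?thesis by (simp add: G'_def)
qed

text \<open>The derivatives of the polynomial approximation \<open>r\<close>, cleared of
  denominators, satisfy the linear system of \<open>linear_sol_dvd\<close> and are thus divisible by
  \<open>(u - a)^k\<close>. So their Taylor coefficients of order below \<open>k\<close> vanish, and
  these are multiples of the derivatives in question.\<close>

lemma zfield_derivation_sol:
  assumes F: "sol F" and D: "good_derivation D" "D ` zfield \<subseteq> zfield" and j: "j < n" and m: "m < k"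
  shows "D (to_fract (eval_u a ((Delta a ^^ m) (F j)))) = 0"
proof -
  have der: "derivation_on UNIV D" and X: "D (to_fract fps_X) = 0"
    using D unfolding good_derivation_def by blast+
  note dD = derivation_onD[OF der]
  obtain d B where d: "d $ 0 = [:-a, 1:] ^ (k * n)"
    "\<And>i j. i < n \<Longrightarrow> j < n \<Longrightarrow> (\<Sum>l<n. jac F i l * B l j) = (if i = j then d else 0)"
    "\<And>i j. i < n \<Longrightarrow> j < n \<Longrightarrow> (\<Sum>l<n. B i l * jac F l j) = (if i = j then d else 0)"
    by (rule jac_adjugate[of F]) (rule that)
  obtain q where q: "umonic (k * n) (d * q)" by (rule umonic_multiple_exists[OF d(1)])
  define W where "W = d * q"
  have W: "umonic (k * n) W" using q by (simp add: W_def)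
  obtain r Q h where r: "\<And>j. r j \<in> useries" "\<And>j. r j = F j - u_minus a ^ k * (W\<^sup>2 * Q j)"
    "\<And>i. i < n \<Longrightarrow> r i - rhs r i = W\<^sup>2 * h i" "\<And>i. i < n \<Longrightarrow> h i \<in> useries"
    by (rule polynomial_approximation[OF F W]) (rule that)
  define rl where "rl j l = (Delta a ^^ l) (r j)" for j l
  define y where "y j l = eval_u a (rl j l)" for j l
  have rl: "rl j l \<in> useries" for j l
    unfolding rl_def using r(1) by (induction l) (auto intro: Delta_useries)
  have rF: "rl j l = (Delta a ^^ l) (F j) - u_minus a ^ (k - l) * (W\<^sup>2 * Q j)" if "l \<le> k" for j l
    unfolding rl_def r(2) Delta_pow_diff by (simp only: Delta_pow_u_minus[OF that])
  \<comment> \<open>For \<open>l < k\<close> the correction term still has a factor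
    \<open>u - a\<close>, so \<open>r\<close> and \<open>F\<close> share these Taylor
    coefficients.\<close>
  have yF: "y j l = eval_u a ((Delta a ^^ l) (F j))" if "l < k" for j l
  proof -
    have "u_minus a ^ (k - l) = u_minus a * u_minus a ^ (k - Suc l)"
      using that by (metis Suc_diff_Suc power_Suc)
    then show ?thesis using rF[of l j] that by (simp add: y_def)
  qed

  \<comment> \<open>These are the derivatives that need a common denominator. For \<open>X2\<close>
    the cleared values must also lie in K[[t]], so that \<open>Delta_unique\<close> can recognise
    them as evaluations.\<close>
  define X1 where "X1 = (\<lambda>(j, l). D (to_fract (rl j l))) ` ({..<n} \<times> {..k}) \<union>
    {D (to_fract W)} \<union> (\<lambda>i. D (to_fract (h i))) ` {..<n}"
  define X2 where "X2 = (\<lambda>(j, l). D (to_fract (y j l))) ` ({..<n} \<times> {..<k})"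
  have "\<exists>c\<in>zseries. c \<noteq> 0 \<and> (\<forall>x\<in>X1. \<exists>s\<in>UNIV. to_fract c * x = to_fract s)"
  proof (rule fractions_common_denominator)
    show "X1 \<subseteq> fractions UNIV zseries"
      using derivation_useries[OF D] rl r(4) umonic_useries[OF W] by (auto simp: X1_def)
  qed (use subring_zseries in \<open>auto simp: X1_def is_subring_def\<close>)
  then obtain c1 where c1: "c1 \<in> zseries" "c1 \<noteq> 0" "\<And>x. x \<in> X1 \<Longrightarrow> \<exists>s. to_fract c1 * x = to_fract s"
    by blast
  have "\<exists>c\<in>zseries. c \<noteq> 0 \<and> (\<forall>x\<in>X2. \<exists>s\<in>zseries. to_fract c * x = to_fract s)"
  proof (rule fractions_common_denominator)
    have "to_fract (y j l) \<in> zfield" for j l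
      unfolding zfield_def y_def by (intro to_fract_fractions subring_zseries eval_u_zseries)
    then have "D (to_fract (y j l)) \<in> zfield" for j l using D(2) by blast
    then show "X2 \<subseteq> fractions zseries zseries" by (auto simp: X2_def simp flip: zfield_def)
  qed (use subring_zseries in \<open>auto simp: X2_def\<close>)
  then obtain c2 where c2: "c2 \<in> zseries" "c2 \<noteq> 0" "\<And>x. x \<in> X2 \<Longrightarrow> \<exists>s\<in>zseries. to_fract c2 * x = to_fract s"
    by blast
  define c where "c = to_fract (c1 * c2)"
  have c0: "c \<noteq> 0" using c1 c2 by (simp add: c_def)
  have cX1: "\<exists>s. c * x = to_fract s" if "x \<in> X1" for x
  proof -
    obtain s where "to_fract c1 * x = to_fract s" using c1(3)[OF \<open>x \<in> X1\<close>] by blast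
    then have "c * x = to_fract (c2 * s)" by (simp add: c_def mult_ac)
    then show ?thesis by blast
  qed
  have cX2: "\<exists>s\<in>zseries. c * x = to_fract s" if "x \<in> X2" for x
  proof -
    obtain s where s: "to_fract c2 * x = to_fract s" "s \<in> zseries" using c2(3)[OF \<open>x \<in> X2\<close>] by blast
    then have "c * x = to_fract (c1 * s)" by (simp add: c_def mult_ac)
    moreover have "c1 * s \<in> zseries" using s(2) c1(1) subring_zseries unfolding is_subring_def by blast
    ultimately show ?thesis by blast
  qed
  have "\<exists>s. c * D (to_fract (rl j l)) = to_fract s" if "j < n" "l \<le> k" for j l
    by (rule cX1) (use that in \<open>force simp: X1_def\<close>)
  then obtain G where G: "\<And>j l. j < n \<Longrightarrow> l \<le> k \<Longrightarrow> c * D (to_fract (rl j l)) = to_fract (G j l)"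
    by metis
  have "\<exists>s. c * D (to_fract (h i)) = to_fract s" if "i < n" for i
    by (rule cX1) (use that in \<open>auto simp: X1_def\<close>)
  then obtain h' where h': "\<And>i. i < n \<Longrightarrow> c * D (to_fract (h i)) = to_fract (h' i)"
    by metis
  obtain w where w: "c * D (to_fract W) = to_fract w"
    using cX1[of "D (to_fract W)"] by (auto simp: X1_def)
  have "\<exists>s\<in>zseries. c * D (to_fract (y j l)) = to_fract s" if "j < n" "l < k" for j l
    by (rule cX2) (use that in \<open>force simp: X2_def\<close>)
  then obtain z where z: "\<And>j l. j < n \<Longrightarrow> l < k \<Longrightarrow> z j l \<in> zseries"
      "\<And>j l. j < n \<Longrightarrow> l < k \<Longrightarrow> c * D (to_fract (y j l)) = to_fract (z j l)"
    by metis

  \<comment> \<open>\<open>D\<close> commutes with divided differences: applied to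
    \<open>(u - a) * Delta a A = A - eval_u a A\<close>, it gives an equation of the same shape, as
    \<open>D\<close> kills \<open>u - a\<close> and \<open>z j l\<close> lies in K[[t]].\<close>
  have GS: "z j l = eval_u a (G j l) \<and> G j (Suc l) = Delta a (G j l)" if jl: "j < n" "l < k" for j l
  proof -
    have "u_minus a * rl j (Suc l) = rl j l - y j l" by (simp add: rl_def y_def u_minus_Delta)
    then have "D (to_fract (u_minus a * rl j (Suc l))) = D (to_fract (rl j l - y j l))" by simp
    then have "to_fract (u_minus a) * D (to_fract (rl j (Suc l))) = D (to_fract (rl j l)) - D (to_fract (y j l))"
      by (simp add: dD derivation_u_minus[OF D(1)])
    then have "to_fract (u_minus a) * (c * D (to_fract (rl j (Suc l)))) =
        c * D (to_fract (rl j l)) - c * D (to_fract (y j l))"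
      by (simp add: right_diff_distrib[symmetric] mult.left_commute)
    then have "to_fract (u_minus a * G j (Suc l)) = to_fract (G j l - z j l)"
      using jl by (simp add: G z(2))
    then have "u_minus a * G j (Suc l) = G j l - z j l" by (simp only: to_fract_eq_iff)
    then show ?thesis using Delta_unique z(1)[OF jl] by blast
  qed
  have Gl: "G j l = (Delta a ^^ l) (G j 0)" if "j < n" "l \<le> k" for j l
    using that(2) GS[OF that(1)] by (induction l) auto

  \<comment> \<open>The gradient at \<open>r\<close>; since \<open>r\<close> and \<open>F\<close>
    agree modulo \<open>W\<^sup>2\<close>, it differs from \<open>grad F\<close> by a multiple of
    \<open>W\<close>.\<close>
  define g where "g i p = peval (asg r) (pdiff (VarY p) (e i))" for i p
  have "\<exists>t. g i p = grad F i p + W * t" if i: "i < n" for i p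
  proof -
    have "W dvd asg r v - asg F v" if "v \<in> pvars (pdiff (VarY p) (e i))" for v
    proof (cases v)
      case (VarY p')
      with that vars[OF i] pvars_pdiff[of "VarY p" "e i"] have p': "p' < n * Suc k" by auto
      have "asg r v - asg F v = - (u_minus a ^ (k - p' mod Suc k) * (W\<^sup>2 * Q (p' div Suc k)))"
        using VarY rF[OF index_div_mod(2), of "p' div Suc k"] by (simp add: asg_def rl_def)
      also have "\<dots> = W * - (u_minus a ^ (k - p' mod Suc k) * (W * Q (p' div Suc k)))"
        by (simp add: power2_eq_square mult_ac)
      finally show ?thesis by simp
    qed (simp_all add: asg_def)
    then have "W dvd g i p - grad F i p" unfolding g_def grad_def by (rule dvd_peval_diff)
    then obtain t where "g i p - grad F i p = W * t" by (elim dvdE)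
    then have "g i p = grad F i p + W * t" by (simp add: algebra_simps)
    then show ?thesis by blast
  qed
  then obtain t where t: "\<And>i p. i < n \<Longrightarrow> g i p = grad F i p + W * t i p" by metis
  \<comment> \<open>The cofactor of \<open>W\<close> in the error: two terms from differentiating
    \<open>W\<^sup>2 * h i\<close>, the last from replacing \<open>g\<close> by
    \<open>grad F\<close>.\<close>
  define H where "H i = 2 * w * h i + W * h' i +
    fps_X * (\<Sum>p<n * Suc k. t i p * G (p div Suc k) (p mod Suc k))" for i

  have eq: "G i 0 = fps_X * (\<Sum>p<n * Suc k. grad F i p * (Delta a ^^ (p mod Suc k)) (G (p div Suc k) 0)) +
      d * q * H i" if i: "i < n" for i
  proof -
    have "D (to_fract (r i)) - D (to_fract (rhs r i)) = D (to_fract (W\<^sup>2 * h i))"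
      using r(3)[OF i] by (simp flip: dD(5) add: to_fract_diff[symmetric])
    moreover have "D (to_fract (rhs r i)) = to_fract fps_X * (\<Sum>p<n * Suc k. to_fract (g i p) *
        D (to_fract (rl (p div Suc k) (p mod Suc k))))"
      by (simp add: rhs_def dD X good_derivation_const[OF D(1)] derivation_peval_asg[OF D(1) i] g_def grad_def rl_def)
    moreover have "D (to_fract (W\<^sup>2 * h i)) =
        to_fract W * (2 * D (to_fract W) * to_fract (h i) + to_fract W * D (to_fract (h i)))"
      by (simp add: power2_eq_square dD algebra_simps)
    ultimately have "D (to_fract (r i)) - to_fract fps_X * (\<Sum>p<n * Suc k. to_fract (g i p) *
        D (to_fract (rl (p div Suc k) (p mod Suc k)))) =
        to_fract W * (2 * D (to_fract W) * to_fract (h i) + to_fract W * D (to_fract (h i)))" by simp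
    then have "c * D (to_fract (r i)) - to_fract fps_X * (\<Sum>p<n * Suc k. to_fract (g i p) *
        (c * D (to_fract (rl (p div Suc k) (p mod Suc k))))) =
        to_fract W * (2 * (c * D (to_fract W)) * to_fract (h i) + to_fract W * (c * D (to_fract (h i))))"
      by (simp add: mult.left_commute[of _ c] sum_distrib_left[symmetric] right_diff_distrib[symmetric]
          distrib_left[symmetric] mult.assoc)
    moreover have "c * D (to_fract (r i)) = to_fract (G i 0)"
      using G[OF i, of 0] by (simp add: rl_def)
    moreover have "(\<Sum>p<n * Suc k. to_fract (g i p) * (c * D (to_fract (rl (p div Suc k) (p mod Suc k))))) =
        to_fract (\<Sum>p<n * Suc k. g i p * G (p div Suc k) (p mod Suc k))"
      unfolding to_fract_sum by (intro sum.cong refl) (use index_div_mod in \<open>simp add: G\<close>)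
    moreover have two: "to_fract (2 :: 'a poly fps) = 2"
      by (metis one_add_one to_fract_1 to_fract_add)
    ultimately have "to_fract (G i 0 - fps_X * (\<Sum>p<n * Suc k. g i p * G (p div Suc k) (p mod Suc k))) =
        to_fract (W * (2 * w * h i + W * h' i))"
      by (simp add: w h'[OF i] two)
    then have "G i 0 - fps_X * (\<Sum>p<n * Suc k. g i p * G (p div Suc k) (p mod Suc k)) =
        W * (2 * w * h i + W * h' i)" by (simp only: to_fract_eq_iff)
    moreover have "(\<Sum>p<n * Suc k. g i p * G (p div Suc k) (p mod Suc k)) =
        (\<Sum>p<n * Suc k. grad F i p * (Delta a ^^ (p mod Suc k)) (G (p div Suc k) 0)) +
        W * (\<Sum>p<n * Suc k. t i p * G (p div Suc k) (p mod Suc k))"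
    proof -
      have "(\<Sum>p<n * Suc k. g i p * G (p div Suc k) (p mod Suc k)) =
        (\<Sum>p<n * Suc k. grad F i p * G (p div Suc k) (p mod Suc k) +
          W * (t i p * G (p div Suc k) (p mod Suc k)))"
        by (simp add: t[OF i] distrib_right mult.assoc)
      also have "\<dots> = (\<Sum>p<n * Suc k. grad F i p * G (p div Suc k) (p mod Suc k)) +
          W * (\<Sum>p<n * Suc k. t i p * G (p div Suc k) (p mod Suc k))"
        by (simp add: sum.distrib sum_distrib_left)
      also have "(\<Sum>p<n * Suc k. grad F i p * G (p div Suc k) (p mod Suc k)) =
          (\<Sum>p<n * Suc k. grad F i p * (Delta a ^^ (p mod Suc k)) (G (p div Suc k) 0))"
      proof (intro sum.cong refl)
        fix p assume "p \<in> {..<n * Suc k}"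
        then have "G (p div Suc k) (p mod Suc k) = (Delta a ^^ (p mod Suc k)) (G (p div Suc k) 0)"
          using index_div_mod by (intro Gl) auto
        then show "grad F i p * G (p div Suc k) (p mod Suc k) =
            grad F i p * (Delta a ^^ (p mod Suc k)) (G (p div Suc k) 0)" by (simp only:)
      qed
      finally show ?thesis .
    qed
    ultimately show ?thesis by (simp add: H_def W_def[symmetric] algebra_simps)
  qed
  have "u_minus a ^ k dvd G j 0" by (rule linear_sol_dvd[OF d(2) eq j])
  then obtain C where C: "G j 0 = u_minus a ^ k * C" by (elim dvdE)
  \<comment> \<open>As \<open>m < k\<close>, a factor \<open>u - a\<close> remains and evaluation at
    \<open>a\<close> gives 0.\<close>
  have "G j m = u_minus a ^ (k - m) * C"
    using Gl[OF j, of m] C Delta_pow_u_minus[of m k a C] m by simp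
  moreover have "u_minus a ^ (k - m) = u_minus a * u_minus a ^ (k - Suc m)"
    using m by (metis Suc_diff_Suc power_Suc)
  ultimately have "z j m = 0" using GS[OF j m] by simp
  then show ?thesis using z(2)[OF j m] c0 yF[OF m, of j] by simp
qed

text \<open>Two kinds of derivations are used. Those preserving K((t)) show that the Taylor
  coefficients are algebraic; hence every derivation that is zero on K(t,u) kills them, and by
  \<open>sol_derivation\<close> also \<open>F i\<close>. A transcendental \<open>F i\<close> would
  admit one with value 1.\<close>

lemma sol_algebraic:
  assumes F: "sol F" and i: "i < n"
  shows "algebraic_over rat_funs (to_fract (F i))"
proof (rule ccontr)
  assume "\<not> ?thesis"
  then obtain D where D: "derivation_on UNIV D" "\<And>y. y \<in> rat_funs \<Longrightarrow> D y = 0" "D (to_fract (F i)) = 1"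
    by (rule derivation_extend[OF subfield_UNIV subfield_rat_funs subset_UNIV derivation_on_zero subset_UNIV
          UNIV_I UNIV_I, of _ 1]) (rule that)
  have "D (to_fract (eval_u a ((Delta a ^^ m) (F j)))) = 0" if "j < n" "m < k" for j m
  proof -
    have "algebraic_over rat_funs (to_fract (eval_u a ((Delta a ^^ m) (F j))))"
    proof (rule ccontr)
      assume "\<not> ?thesis"
      then obtain D' where D': "good_derivation D'" "D' ` zfield \<subseteq> zfield"
        "D' (to_fract (eval_u a ((Delta a ^^ m) (F j)))) = 1"
        by (rule zseries_derivation_exists[OF eval_u_zseries]) (rule that)
      with zfield_derivation_sol[OF F D'(1,2) \<open>j < n\<close> \<open>m < k\<close>] show False by simp
    qed
    with D(1) subfield_rat_funs D(2) show ?thesis by (rule derivation_algebraic)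
  qed
  moreover have "good_derivation D" using D(1,2) by (rule good_derivation_if_rat_funs)
  ultimately have "D (to_fract (F i)) = 0" using sol_derivation[OF F _ _ i] by blast
  with D(3) show False by simp
qed

end

section \<open>Transfer to lists and multivariate polynomials\<close>

lemma nth_concat_nabla:
  "p < length Fs * Suc k \<Longrightarrow>
    concat (map (nabla c k) Fs) ! p = (Delta c ^^ (p mod Suc k)) (Fs ! (p div Suc k))"
proof (induction Fs arbitrary: p)
  case (Cons F Fs)
  have len: "length (nabla c k F) = Suc k" by (simp add: nabla_def del: upt_Suc)
  show ?case
  proof (cases "p < Suc k")
    case True
    then show ?thesis by (simp add: nth_append len nabla_def del: upt_Suc)
  next
    case False
    then have p: "p div Suc k = Suc ((p - Suc k) div Suc k)" "p mod Suc k = (p - Suc k) mod Suc k"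
      by (simp_all add: le_div_geq le_mod_geq)
    have "p - Suc k < length Fs * Suc k" using Cons.prems False by simp
    from Cons.IH[OF this] show ?thesis using False by (simp add: nth_append len p)
  qed
qed simp

theorem theorem1:
  fixes a :: rat and n k :: nat
    and fs :: "'a::field_char_0 poly list" and Qs :: "'a mpoly list"
  assumes "n \<ge> 1" and "k \<ge> 1"
    and "length fs = n" and "length Qs = n"
    and "\<And>Q. Q \<in> set Qs \<Longrightarrow> Q \<in> mpolys_in (n * (k + 1))"
  shows "(\<exists>!Fs. length Fs = n \<and> is_solution (of_rat a) k fs Qs Fs) \<and>
    (\<forall>Fs. length Fs = n \<and> is_solution (of_rat a) k fs Qs Fs \<longrightarrow>
      (\<forall>F\<in>set Fs. algebraic_over rat_funs (to_fract F)))"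
proof -
  have "\<forall>i. \<exists>e. pvars e \<subseteq> indets (Qs ! i) \<and> (\<forall>x. subst_mpoly x (Qs ! i) = peval x e)"
    using subst_mpoly_pexp by blast
  then obtain e where e: "\<And>i. pvars (e i) \<subseteq> indets (Qs ! i)"
    "\<And>i x. subst_mpoly x (Qs ! i) = peval x (e i)" by metis
  have vars: "pvars (e i) \<subseteq> VarY ` {..<n * Suc k} \<union> {VarT, VarU}" if "i < n" for i
    using e(1)[of i] assms(5)[of "Qs ! i"] nth_mem[of i Qs] that assms(4)
    unfolding mpolys_in_def by auto
  interpret catalytic "of_rat a :: 'a" n k "\<lambda>i. fs ! i" e
    by unfold_locales (rule vars)
  have sol_iff: "is_solution (of_rat a) k fs Qs Fs \<longleftrightarrow> sol (\<lambda>i. Fs ! i)" if len: "length Fs = n" for Fs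
  proof -
    have "subst_mpoly (assign (concat (map (nabla (of_rat a) k) Fs))) (Qs ! i) =
        peval (asg (\<lambda>i. Fs ! i)) (e i)" if i: "i < n" for i
      unfolding e(2)
    proof (rule peval_cong)
      fix v assume "v \<in> pvars (e i)"
      then show "assign (concat (map (nabla (of_rat a) k) Fs)) v = asg (\<lambda>i. Fs ! i) v"
        using vars[OF i] len by (cases v) (auto simp: asg_def nth_concat_nabla simp del: mult_Suc_right)
    qed
    then show ?thesis unfolding is_solution_def sol_def rhs_def using len by simp
  qed
  obtain F where F: "sol F" using sol_exists by blast
  \<comment> \<open>Being a solution depends only on the components below \<open>n\<close>, whereas
    a list index function and \<open>F\<close> may differ beyond \<open>n\<close>.\<close>
  have cong: "sol G" if "sol F" "\<And>i. i < n \<Longrightarrow> G i = F i" for F G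
  proof -
    have "rhs G i = rhs F i" if "i < n" for i
    proof -
      have "fps_X ^ m dvd rhs G i - rhs F i" for m
        using rhs_cong[of m G F i] \<open>\<And>i. i < n \<Longrightarrow> G i = F i\<close> \<open>i < n\<close>
        by (auto intro: power_le_dvd[of _ "Suc m"])
      then have "rhs G i - rhs F i = 0" by (rule fps_eq_0_if_X_dvd)
      then show ?thesis by simp
    qed
    then show ?thesis using that unfolding sol_def by simp
  qed
  define Fs where "Fs = map F [0..<n]"
  have len: "length Fs = n" by (simp add: Fs_def)
  have "sol (\<lambda>i. Fs ! i)" by (rule cong[OF F]) (simp add: Fs_def)
  then have ex: "is_solution (of_rat a) k fs Qs Fs" using sol_iff[OF len] by blast
  have uniq: "Gs = Fs" if "length Gs = n" "is_solution (of_rat a) k fs Qs Gs" for Gs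
    using that len ex sol_iff sol_unique by (intro nth_equalityI) auto
  have alg: "algebraic_over rat_funs (to_fract G)"
    if Gs: "length Gs = n" "is_solution (of_rat a) k fs Qs Gs" "G \<in> set Gs" for Gs G
    using sol_algebraic[of "\<lambda>i. Gs ! i"] Gs sol_iff by (auto simp: in_set_conv_nth)
  show ?thesis using len ex uniq alg by blast
qed

end
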